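(* Let $\mathcal H$ be a family of (non-empty) edge-ordered graphs. (1) $\chi'_<(\mathcal H)=\infty$ if and only if one of the four canonical edge-orders of $K_n$ (min-labeling, max-labeling, inverse min-labeling, inverse max-labeling) avoids $\mathcal H$ for all $n$. (2) For any $k\ge 2$, $\chi'_<(\mathcal H)>k$ if and only if for all $n$ one of the canonical edge-orders of $K_{k\times n}$ avoids $\mathcal H$.
   Context: Edge-ordered graph: finite simple graph with a linear order on its edges; isomorphisms preserve edge order; subgraphs carry the induced order; $G$ contains $H$ if a subgraph of $G$ is isomorphic to $H$, otherwise avoids it; avoiding a family means avoiding each member. A simple graph can avoid $\mathcal H$ if some edge-ordering of it avoids $\mathcal H$. $\chi'_<(\mathcal H)$ (order chromatic number) is the least $\chi(G)$ over finite simple graphs $G$ that cannot avoid $\mathcal H$, or $\infty$ if all finite graphs can avoid $\mathcal H$. Canonical labelings of $K_n$ on vertices $v_1,\dots,v_n$ (for $i<j$): min-labeling $L(v_iv_j)=ni+j$; max-labeling $L(v_iv_j)=nj+i$; inverse min-labeling $L(v_iv_j)=ni-j$; inverse max-labeling $L(v_iv_j)=nj-i$ (edge order is the order of labels). $K_{k\times n}$ is the complete $k$-partite graph with vertices $v_{i,j}$ ($1\le i\le k$, $1\le j\le n$), classes $V_i=\{v_{i,j}:1\le j\le n\}$, two vertices adjacent iff in different classes. A part is the complete bipartite subgraph induced by $V_{i_1}\cup V_{i_2}$, $i_1\ne i_2$. An edge-ordering of this part is canonical if it is induced by one of the eight labelings of $v_{i_1,j_1}v_{i_2,j_2}$: $nj_1+j_2$,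 $nj_1-j_2$, $-nj_1+j_2$, $-nj_1-j_2$, $nj_2+j_1$, $nj_2-j_1$, $-nj_2+j_1$, $-nj_2-j_1$. A part precedes another if all its edges come before all edges of the other. The edge-ordering interleaves the distinct parts on $V_{i_1}\cup V_{i_2}$ and $V_{i_1}\cup V_{i_4}$ if one of the following holds for all $j_1,j_2,j_3,j_4$: edge $v_{i_1,j_1}v_{i_2,j_2}$ precedes $v_{i_1,j_3}v_{i_4,j_4}$ iff $j_1<j_3$; or iff $j_1\le j_3$; or iff $j_1>j_3$; or iff $j_1\ge j_3$. An edge-ordering of $K_{k\times n}$ is canonical if it induces a canonical edge-ordering on every part and for every two distinct parts either one precedes the other or they are interleaved. *)

theory Defs
  imports Complex_Main "HOL-Library.Extended_Nat" "HOL-Library.Ramsey"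
begin

section \<open>Simple graphs and edge-ordered graphs\<close>

record 'a sgraph =
  verts :: "'a set"
  edges :: "'a set set"

record 'a eograph = "'a sgraph" +
  eord :: "'a set rel"

definition simple_graph :: "('a, 'z) sgraph_scheme \<Rightarrow> bool" where
  "simple_graph G \<longleftrightarrow> finite (verts G) \<and> edges G \<subseteq> [verts G]\<^bsup>2\<^esup>"

text \<open>Edge orders are reflexive: \<open>(d, e) \<in> R\<close> means that \<open>d\<close> equals or precedes \<open>e\<close>.\<close>

definition edge_ordering :: "('a, 'z) sgraph_scheme \<Rightarrow> 'a set rel \<Rightarrow> bool" where
  "edge_ordering G R \<longleftrightarrow> linear_order_on (edges G) R"

definition edge_ordered_graph :: "'a eograph \<Rightarrow> bool" where
  "edge_ordered_graph G \<longleftrightarrow> simple_graph G \<and> edge_ordering G (eord G)"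

definition with_order :: "'a sgraph \<Rightarrow> 'a set rel \<Rightarrow> 'a eograph" where
  "with_order G R = \<lparr>verts = verts G, edges = edges G, eord = R\<rparr>"

definition eo_subgraph :: "'a eograph \<Rightarrow> 'a eograph \<Rightarrow> bool" where
  "eo_subgraph S G \<longleftrightarrow> simple_graph S \<and> verts S \<subseteq> verts G \<and> edges S \<subseteq> edges G \<and>
     eord S = Restr (eord G) (edges S)"

definition eo_isomorphic :: "'a eograph \<Rightarrow> 'b eograph \<Rightarrow> bool" where
  "eo_isomorphic G H \<longleftrightarrow> (\<exists>f. bij_betw f (verts G) (verts H) \<and>
     (\<forall>u\<in>verts G. \<forall>v\<in>verts G. {u, v} \<in> edges G \<longleftrightarrow> {f u, f v} \<in> edges H) \<and>
     (\<forall>d\<in>edges G. \<forall>e\<in>edges G. (d, e) \<in> eord G \<longleftrightarrow> (f ` d, f ` e) \<in> eord H))"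

definition contains :: "'a eograph \<Rightarrow> 'b eograph \<Rightarrow> bool" where
  "contains G H \<longleftrightarrow> (\<exists>S. eo_subgraph S G \<and> eo_isomorphic S H)"

definition avoids :: "'a eograph \<Rightarrow> 'b eograph set \<Rightarrow> bool" where
  "avoids G \<H> \<longleftrightarrow> (\<forall>H\<in>\<H>. \<not> contains G H)"

definition can_avoid :: "'a sgraph \<Rightarrow> 'b eograph set \<Rightarrow> bool" where
  "can_avoid G \<H> \<longleftrightarrow> (\<exists>R. edge_ordering G R \<and> avoids (with_order G R) \<H>)"


section \<open>Order chromatic number\<close>

definition colorable :: "'a sgraph \<Rightarrow> nat \<Rightarrow> bool" where
  "colorable G k \<longleftrightarrow> (\<exists>c :: 'a \<Rightarrow> nat. c ` verts G \<subseteq> {..<k} \<and>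
     (\<forall>u\<in>verts G. \<forall>v\<in>verts G. {u, v} \<in> edges G \<longrightarrow> c u \<noteq> c v))"

definition chromatic_number :: "'a sgraph \<Rightarrow> nat" where
  "chromatic_number G = (LEAST k. colorable G k)"

text \<open>
  Every finite graph is isomorphic to one with vertices in \<^typ>\<open>nat\<close>, so it suffices to let the
  host graph range over these. The infimum of the empty set is \<open>\<infinity>\<close> in \<^typ>\<open>enat\<close>.
\<close>

definition order_chromatic_number :: "'b eograph set \<Rightarrow> enat" where
  "order_chromatic_number \<H> =
     Inf {enat (chromatic_number G) | G :: nat sgraph. simple_graph G \<and> \<not> can_avoid G \<H>}"


section \<open>Canonical edge-orders of complete graphs\<close>

definition complete_graph :: "nat \<Rightarrow> nat sgraph" where
  "complete_graph n = \<lparr>verts = {1..n}, edges = [{1..n}]\<^bsup>2\<^esup>\<rparr>"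

text \<open>The labelings below take \<open>n\<close>, \<open>i\<close>, \<open>j\<close> and give the label of \<open>v\<^sub>iv\<^sub>j\<close> in \<open>K\<^sub>n\<close>, for \<open>i < j\<close>.\<close>

definition min_labeling :: "nat \<Rightarrow> nat \<Rightarrow> nat \<Rightarrow> int" where
  "min_labeling n i j = int n * int i + int j"

definition max_labeling :: "nat \<Rightarrow> nat \<Rightarrow> nat \<Rightarrow> int" where
  "max_labeling n i j = int n * int j + int i"

definition inv_min_labeling :: "nat \<Rightarrow> nat \<Rightarrow> nat \<Rightarrow> int" where
  "inv_min_labeling n i j = int n * int i - int j"

definition inv_max_labeling :: "nat \<Rightarrow> nat \<Rightarrow> nat \<Rightarrow> int" where
  "inv_max_labeling n i j = int n * int j - int i"

definition canonical_labelings :: "(nat \<Rightarrow> nat \<Rightarrow> nat \<Rightarrow> int) set" where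
  "canonical_labelings = {min_labeling, max_labeling, inv_min_labeling, inv_max_labeling}"

definition labeled_complete_graph :: "(nat \<Rightarrow> nat \<Rightarrow> nat \<Rightarrow> int) \<Rightarrow> nat \<Rightarrow> nat eograph" where
  "labeled_complete_graph L n = with_order (complete_graph n)
     {(d, e). d \<in> edges (complete_graph n) \<and> e \<in> edges (complete_graph n) \<and>
        L n (Min d) (Max d) \<le> L n (Min e) (Max e)}"


section \<open>Canonical edge-orders of complete multipartite graphs\<close>

text \<open>The vertex \<open>v\<^bsub>i,j\<^esub>\<close> is the pair \<open>(i, j)\<close>.\<close>

definition complete_multipartite :: "nat \<Rightarrow> nat \<Rightarrow> (nat \<times> nat) sgraph" where
  "complete_multipartite k n = \<lparr>verts = {1..k} \<times> {1..n},
     edges = {{u, v} | u v. u \<in> {1..k} \<times> {1..n} \<and> v \<in> {1..k} \<times> {1..n} \<and> fst u \<noteq> fst v}\<rparr>"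

definition part :: "nat \<Rightarrow> nat \<Rightarrow> nat \<Rightarrow> (nat \<times> nat) set set" where
  "part n i1 i2 = {{(i1, j1), (i2, j2)} | j1 j2. j1 \<in> {1..n} \<and> j2 \<in> {1..n}}"

definition part_labelings :: "nat \<Rightarrow> (int \<Rightarrow> int \<Rightarrow> int) set" where
  "part_labelings n =
    {\<lambda>j1 j2. int n * j1 + j2, \<lambda>j1 j2. int n * j1 - j2,
     \<lambda>j1 j2. - int n * j1 + j2, \<lambda>j1 j2. - int n * j1 - j2,
     \<lambda>j1 j2. int n * j2 + j1, \<lambda>j1 j2. int n * j2 - j1,
     \<lambda>j1 j2. - int n * j2 + j1, \<lambda>j1 j2. - int n * j2 - j1}"

definition canonical_on_part :: "nat \<Rightarrow> (nat \<times> nat) set rel \<Rightarrow> nat \<Rightarrow> nat \<Rightarrow> bool" where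
  "canonical_on_part n R i1 i2 \<longleftrightarrow> (\<exists>L\<in>part_labelings n.
     \<forall>j1\<in>{1..n}. \<forall>j2\<in>{1..n}. \<forall>j3\<in>{1..n}. \<forall>j4\<in>{1..n}.
       ({(i1, j1), (i2, j2)}, {(i1, j3), (i2, j4)}) \<in> R \<longleftrightarrow>
       L (int j1) (int j2) \<le> L (int j3) (int j4))"

definition precedes :: "'a rel \<Rightarrow> 'a \<Rightarrow> 'a \<Rightarrow> bool" where
  "precedes R d e \<longleftrightarrow> (d, e) \<in> R \<and> d \<noteq> e"

definition part_precedes :: "'a rel \<Rightarrow> 'a set \<Rightarrow> 'a set \<Rightarrow> bool" where
  "part_precedes R P Q \<longleftrightarrow> (\<forall>d\<in>P. \<forall>e\<in>Q. precedes R d e)"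

text \<open>Interleaving of the parts on \<open>V\<^bsub>i1\<^esub> \<union> V\<^bsub>i2\<^esub>\<close> and \<open>V\<^bsub>i1\<^esub> \<union> V\<^bsub>i4\<^esub>\<close>, sharing the class \<open>V\<^bsub>i1\<^esub>\<close>.\<close>

definition interleaves :: "nat \<Rightarrow> (nat \<times> nat) set rel \<Rightarrow> nat \<Rightarrow> nat \<Rightarrow> nat \<Rightarrow> bool" where
  "interleaves n R i1 i2 i4 \<longleftrightarrow>
     (\<exists>cmp \<in> {(<), (\<le>), (>), (\<ge>)} :: (nat \<Rightarrow> nat \<Rightarrow> bool) set.
        \<forall>j1\<in>{1..n}. \<forall>j2\<in>{1..n}. \<forall>j3\<in>{1..n}. \<forall>j4\<in>{1..n}.
          precedes R {(i1, j1), (i2, j2)} {(i1, j3), (i4, j4)} \<longleftrightarrow> cmp j1 j3)"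

definition canonical_edge_ordering :: "nat \<Rightarrow> nat \<Rightarrow> (nat \<times> nat) set rel \<Rightarrow> bool" where
  "canonical_edge_ordering k n R \<longleftrightarrow>
     edge_ordering (complete_multipartite k n) R \<and>
     (\<forall>i1\<in>{1..k}. \<forall>i2\<in>{1..k}. i1 \<noteq> i2 \<longrightarrow> canonical_on_part n R i1 i2) \<and>
     (\<forall>i1\<in>{1..k}. \<forall>i2\<in>{1..k}. \<forall>i3\<in>{1..k}. \<forall>i4\<in>{1..k}.
        i1 \<noteq> i2 \<and> i3 \<noteq> i4 \<and> {i1, i2} \<noteq> {i3, i4} \<longrightarrow>
          part_precedes R (part n i1 i2) (part n i3 i4) \<or>
          part_precedes R (part n i3 i4) (part n i1 i2) \<or>
          (\<exists>a b c. {a, b} = {i1, i2} \<and> {a, c} = {i3, i4} \<and> interleaves n R a b c))"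

end

theory Submission
  imports Defs
begin

text \<open>
  A graph that embeds into a canonically ordered host inherits an edge-ordering avoiding the family,
  which gives one direction of each equivalence. For the other, Ramsey's theorem for \<open>4\<close>-sets yields,
  inside every edge-ordering of a sufficiently large host, a large set of vertices on which the
  comparison of two edges depends only on the relative order of their at most four endpoints.
  Transitivity of the edge order then leaves only the canonical patterns. So a host that is large
  enough contains a canonically ordered one, and cannot avoid the family if none of those does.
\<close>

section \<open>Order-homogeneous sets\<close>

text \<open>The quantifiers of the two equivalences differ. In (1) a single labeling must work for
  every n, while the Ramsey step only finds some labeling for each n. Canonical orders of one type
  are nested as n grows, so if each of the four types fails to avoid the family at some size, all
  four fail at the largest of these sizes, and one Ramsey host for that size suffices. In (2) the
  order may change with n, and each n is treated alone. Two edges may share endpoints, so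
  homogeneity is needed for tuples with repeated entries, whereas Ramsey's theorem speaks of sets;
  \<open>same_order_type\<close> and \<open>rank\<close> bridge the two. Edge orders are handled as
  injective labelings by natural numbers, which turns the pattern arguments into chains of
  inequalities. Containment is handled as an order-preserving injection, so that avoidance is
  transported by composing maps.\<close>

text \<open>The map \<open>f b\<close> to \<open>g b\<close> is well defined and injective because
  the kernels agree. It is needed for lists with repetitions, where counting positions would
  overcount entries.\<close>

lemma card_image_cong_kernel:
  assumes "\<And>b c. b \<in> B \<Longrightarrow> c \<in> B \<Longrightarrow> f b = f c \<longleftrightarrow> g b = g c"
  shows "card (f ` B) = card (g ` B)"
proof -
  define h where "h = (\<lambda>u. g (inv_into B f u))"
  have h: "h (f b) = g b" if "b \<in> B" for b
    unfolding h_def using assms that by (metis f_inv_into_f image_eqI inv_into_into)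
  have "bij_betw h (f ` B) (g ` B)"
    unfolding bij_betw_def inj_on_def using h assms by (auto simp: image_image)
  then show ?thesis by (rule bij_betw_same_card)
qed

definition rank :: "nat set \<Rightarrow> nat \<Rightarrow> nat" where
  "rank S u = card {v \<in> S. v < u}"

lemma rank_less_iff:
  assumes "finite S" "u \<in> S" "v \<in> S"
  shows "rank S u < rank S v \<longleftrightarrow> u < v"
proof -
  have *: "rank S a < rank S b" if "a < b" "a \<in> S" for a b
    unfolding rank_def by (rule psubset_card_mono) (use that assms(1) in auto)
  then show ?thesis using assms by (metis less_asym less_irrefl linorder_neqE_nat)
qed

lemma inj_on_rank: "finite S \<Longrightarrow> inj_on (rank S) S"
  by (metis inj_onI less_irrefl linorder_neqE_nat rank_less_iff)

lemma rank_less_card: "finite S \<Longrightarrow> u \<in> S \<Longrightarrow> rank S u < card S"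
  unfolding rank_def by (rule psubset_card_mono) auto

lemma rank_image_strict_mono_on:
  assumes "strict_mono_on A z" "B \<subseteq> A" "u \<in> A"
  shows "rank (z ` B) (z u) = rank B u"
proof -
  have lt: "z a < z b \<longleftrightarrow> a < b" if "a \<in> A" "b \<in> A" for a b
    using assms(1) that by (metis less_asym less_irrefl linorder_neqE_nat strict_mono_onD)
  have "{v \<in> z ` B. v < z u} = z ` {v \<in> B. v < u}"
    using lt assms(2,3) by auto
  moreover have "inj_on z {v \<in> B. v < u}"
    by (rule inj_on_subset[OF strict_mono_on_imp_inj_on[OF assms(1)]]) (use assms(2) in auto)
  ultimately show ?thesis unfolding rank_def by (simp add: card_image)
qed

text \<open>All ordered pairs of positions are compared, so equality of two entries is recorded too,
  as the failure of both strict inequalities. Tuples of edges sharing a vertex therefore have types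
  of their own.\<close>

definition same_order_type :: "nat list \<Rightarrow> nat list \<Rightarrow> bool" where
  "same_order_type x y \<longleftrightarrow> length x = length y \<and>
     (\<forall>a<length x. \<forall>b<length x. x ! a < x ! b \<longleftrightarrow> y ! a < y ! b)"

lemma same_order_type_eq_iff:
  assumes "same_order_type x y" "a < length x" "b < length x"
  shows "x ! a = x ! b \<longleftrightarrow> y ! a = y ! b"
  using assms unfolding same_order_type_def by (metis less_irrefl linorder_neqE_nat)

text \<open>The entries below the \<open>a\<close>-th one sit at the same positions in both lists,
  and the lists repeat entries at the same positions, so equally many distinct values lie
  below.\<close>

lemma same_order_type_rank:
  assumes "same_order_type x y" "a < length x"
  shows "rank (set x) (x ! a) = rank (set y) (y ! a)"
proof -
  let ?B = "{b. b < length x \<and> x ! b < x ! a}"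
  have "{v \<in> set x. v < x ! a} = (!) x ` ?B" "{v \<in> set y. v < y ! a} = (!) y ` ?B"
    using assms by (auto simp: same_order_type_def set_conv_nth)
  moreover have "card ((!) x ` ?B) = card ((!) y ` ?B)"
    by (rule card_image_cong_kernel) (use same_order_type_eq_iff[OF assms(1)] in auto)
  ultimately show ?thesis by (simp add: rank_def)
qed

text \<open>
  Colour an \<open>r\<close>-set by the predicates holding on its tuples, each tuple being recorded by the ranks
  of its entries. A tuple with fewer than \<open>r\<close> distinct entries is padded to an \<open>r\<close>-set from above,
  which leaves the ranks of its entries unchanged.
\<close>

lemma ramsey_order_type:
  fixes T :: "'t set" and m r :: nat
  assumes "finite T"
  obtains N :: nat where
    "\<And>P :: 't \<Rightarrow> nat list \<Rightarrow> bool. \<exists>z. strict_mono_on {1..m} z \<and> z ` {1..m} \<subseteq> {1..N} \<and>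
      (\<forall>t\<in>T. \<forall>x y. length x = r \<longrightarrow> set x \<union> set y \<subseteq> {1..m} \<longrightarrow> same_order_type x y \<longrightarrow>
         P t (map z x) = P t (map z y))"
proof -
  \<comment> \<open>The possible colours: sets of pairs of a tag and a list of \<open>r\<close>
    ranks. There are finitely many, as Ramsey's theorem requires.\<close>
  define C where "C = Pow (T \<times> {l :: nat list. set l \<subseteq> {..<r} \<and> length l = r})"
  have finC: "finite C" unfolding C_def by (simp add: assms finite_lists_length_eq)
  obtain h :: "('t \<times> nat list) set \<Rightarrow> nat" where h: "bij_betw h C {0..<card C}"
    using ex_bij_betw_finite_nat[OF finC] by blast
  \<comment> \<open>The extra \<open>r\<close> elements leave room above the \<open>m\<close>
    selected ones for padding any tuple to an \<open>r\<close>-set.\<close>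
  obtain N :: nat where N: "partn_lst {..<N} (replicate (card C) (m + r)) r"
    using ramsey_full by blast
  show thesis
  proof (rule that[of N])
    fix P :: "'t \<Rightarrow> nat list \<Rightarrow> bool"
    \<comment> \<open>Ramsey's theorem is applied to vertices counted from 0, while the hosts count
      from 1; \<open>Suc\<close> translates.\<close>
    define col where "col S = {(t, map (rank S) x) |t x. t \<in> T \<and> length x = r \<and> set x \<subseteq> S \<and>
      P t (map Suc x)}" for S
    have colC: "col S \<in> C" if "finite S" "card S = r" for S
      unfolding col_def C_def using rank_less_card that by fastforce
    have "(\<lambda>S. h (col S)) \<in> [{..<N}]\<^bsup>r\<^esup> \<rightarrow> {..<card C}"
      using h colC by (fastforce simp: nsets_def bij_betw_def)
    then obtain i H where i: "i < card C" and H: "H \<in> [{..<N}]\<^bsup>(m + r)\<^esup>"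
      and hom: "(\<lambda>S. h (col S)) ` [H]\<^bsup>r\<^esup> \<subseteq> {i}"
      using partn_lstE[OF N] by (metis length_replicate nth_replicate)
    have col_eq: "col S = col S'" if "S \<in> [H]\<^bsup>r\<^esup>" "S' \<in> [H]\<^bsup>r\<^esup>" for S S'
    proof -
      have "h (col S) = h (col S')" using hom that by auto
      moreover have "col S \<in> C" "col S' \<in> C" using that colC by (auto simp: nsets_def)
      ultimately show ?thesis using h by (meson bij_betw_def inj_onD)
    qed
    have Hf: "finite H" "card H = m + r" "H \<subseteq> {..<N}" using H by (auto simp: nsets_def)
    obtain z where z: "strict_mono_on {..<m+r} z" "\<And>n. n < m + r \<Longrightarrow> z n \<in> H"
      using finite_enumerate[OF Hf(1)] Hf(2) by auto
    have injz: "inj_on z {..<m+r}" using z(1) by (rule strict_mono_on_imp_inj_on)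
    have key: "P t (map Suc (map z x)) = P t (map Suc (map z y))"
      if t: "t \<in> T" and len: "length x = r" and sub: "set x \<union> set y \<subseteq> {..<m}"
        and so: "same_order_type x y" for t x y
    proof -
      \<comment> \<open>These are indices into \<open>z\<close>, not yet vertices. The padding
        starts at \<open>m\<close>, above every index occurring in \<open>x\<close>.\<close>
      define B where "B x = set x \<union> {m..<m + (r - card (set x))}" for x :: "nat list"
      have Bsub: "B x \<subseteq> {..<m+r}" if "set x \<subseteq> {..<m}" for x :: "nat list"
        unfolding B_def using that by fastforce
      have cardB: "card (B x) = r" if "set x \<subseteq> {..<m}" "length x = r" for x :: "nat list"
      proof -
        have "card (B x) = card (set x) + card {m..<m + (r - card (set x))}"
          unfolding B_def by (rule card_Un_disjoint) (use that in auto)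
        then show ?thesis using card_length[of x] that by simp
      qed
      have zB: "z ` B x \<in> [H]\<^bsup>r\<^esup>" if "set x \<subseteq> {..<m}" "length x = r" for x :: "nat list"
      proof -
        have "card (z ` B x) = r"
          using cardB[OF that] card_image[OF inj_on_subset[OF injz Bsub[OF that(1)]]] by simp
        moreover have "finite (z ` B x)" by (simp add: B_def)
        moreover have "z ` B x \<subseteq> H" using Bsub[OF that(1)] z(2) by blast
        ultimately show ?thesis unfolding nsets_def by blast
      qed
      have rk: "map (rank (z ` B x)) (map z x) = map (rank (set x)) x"
        if "set x \<subseteq> {..<m}" "length x = r" for x :: "nat list"
      proof -
        have "rank (z ` B x) (z u) = rank (set x) u" if u: "u \<in> set x" for u
        proof -
          have "u < m" using u \<open>set x \<subseteq> {..<m}\<close> by auto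
          then have "rank (z ` B x) (z u) = rank (B x) u"
            by (intro rank_image_strict_mono_on[OF z(1)] Bsub[OF \<open>set x \<subseteq> {..<m}\<close>]) auto
          moreover have "{v \<in> B x. v < u} = {v \<in> set x. v < u}"
            unfolding B_def using \<open>u < m\<close> by auto
          ultimately show ?thesis by (simp add: rank_def)
        qed
        then show ?thesis by simp
      qed
      have iff: "P t (map Suc (map z x)) \<longleftrightarrow> (t, map (rank (set x)) x) \<in> col (z ` B x)"
        if x: "set x \<subseteq> {..<m}" "length x = r" for x :: "nat list"
      proof -
        have S: "finite (z ` B x)" "set (map z x) \<subseteq> z ` B x" by (auto simp: B_def)
        \<comment> \<open>Ranks are injective on a finite set, so within one set a rank list comes
          from only one tuple. Membership in the colour thus speaks about this tuple and no
          other.\<close>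
        have inj: "w = map z x" if "set w \<subseteq> z ` B x"
          "map (rank (z ` B x)) w = map (rank (z ` B x)) (map z x)" for w
          by (rule map_inj_on[OF that(2)])
            (rule inj_on_subset[OF inj_on_rank[OF S(1)]], use that(1) S(2) in auto)
        have "P t (map Suc (map z x)) \<longleftrightarrow> (t, map (rank (z ` B x)) (map z x)) \<in> col (z ` B x)"
        proof
          assume "P t (map Suc (map z x))"
          moreover have "length (map z x) = r" using x by simp
          ultimately show "(t, map (rank (z ` B x)) (map z x)) \<in> col (z ` B x)"
            unfolding col_def using t S(2) by blast
        next
          assume "(t, map (rank (z ` B x)) (map z x)) \<in> col (z ` B x)"
          then obtain w where "map (rank (z ` B x)) w = map (rank (z ` B x)) (map z x)"
            "set w \<subseteq> z ` B x" "P t (map Suc w)"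
            unfolding col_def by (smt (verit) Pair_inject mem_Collect_eq)
          then show "P t (map Suc (map z x))" using inj by blast
        qed
        then show ?thesis unfolding rk[OF x] .
      qed
      have y: "set y \<subseteq> {..<m}" "length y = r" using sub so len by (auto simp: same_order_type_def)
      have x: "set x \<subseteq> {..<m}" "length x = r" using sub len by auto
      \<comment> \<open>Equal rank lists tested for membership in equal colours give equal truth
        values.\<close>
      have "map (rank (set x)) x = map (rank (set y)) y"
        using same_order_type_rank[OF so] x y by (auto intro: nth_equalityI)
      then show ?thesis using iff[OF x] iff[OF y] col_eq[OF zB[OF x] zB[OF y]] by simp
    qed
    \<comment> \<open>Shifts the index set to start at 1; the truncated subtraction is only applied
      to positive arguments.\<close>
    let ?z = "\<lambda>u. Suc (z (u - 1))"
    have "strict_mono_on {1..m} ?z"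
      by (rule strict_mono_onI) (use strict_mono_onD[OF z(1)] in auto)
    moreover have "?z ` {1..m} \<subseteq> {1..N}"
    proof
      fix v assume "v \<in> ?z ` {1..m}"
      then obtain u where "u \<in> {1..m}" "v = Suc (z (u - 1))" by blast
      moreover from this have "z (u - 1) \<in> H" by (intro z(2)) auto
      ultimately show "v \<in> {1..N}" using Hf(3) by auto
    qed
    moreover have "P t (map ?z x) = P t (map ?z y)"
      if "t \<in> T" "length x = r" "set x \<union> set y \<subseteq> {1..m}" "same_order_type x y" for t x y
    proof -
      have nth_ge: "1 \<le> x ! a \<and> 1 \<le> y ! a" if "a < length x" for a
      proof -
        have "x ! a \<in> set x" "y ! a \<in> set y"
          using that \<open>same_order_type x y\<close> by (auto simp: same_order_type_def)
        then show ?thesis using \<open>set x \<union> set y \<subseteq> {1..m}\<close> by auto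
      qed
      have "same_order_type (map (\<lambda>u. u - 1) x) (map (\<lambda>u. u - 1) y)"
        unfolding same_order_type_def
      proof (intro conjI allI impI)
        fix a b assume "a < length (map (\<lambda>u. u - 1) x)" "b < length (map (\<lambda>u. u - 1) x)"
        then have ab: "a < length x" "b < length x" "a < length y" "b < length y"
          using \<open>same_order_type x y\<close> by (auto simp: same_order_type_def)
        then have "x ! a < x ! b \<longleftrightarrow> y ! a < y ! b"
          using \<open>same_order_type x y\<close> by (auto simp: same_order_type_def)
        then show "map (\<lambda>u. u - 1) x ! a < map (\<lambda>u. u - 1) x ! b \<longleftrightarrow>
            map (\<lambda>u. u - 1) y ! a < map (\<lambda>u. u - 1) y ! b"
          using nth_ge[OF ab(1)] nth_ge[OF ab(2)] ab by auto
      qed (use \<open>same_order_type x y\<close> in \<open>auto simp: same_order_type_def\<close>)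
      moreover have "set (map (\<lambda>u. u - 1) x) \<union> set (map (\<lambda>u. u - 1) y) \<subseteq> {..<m}"
        using that(3) by fastforce
      ultimately show ?thesis
        using key[of t "map (\<lambda>u. u - 1) x" "map (\<lambda>u. u - 1) y"] that(1,2)
        by (simp add: comp_def)
    qed
    ultimately show "\<exists>z. strict_mono_on {1..m} z \<and> z ` {1..m} \<subseteq> {1..N} \<and>
      (\<forall>t\<in>T. \<forall>x y. length x = r \<longrightarrow> set x \<union> set y \<subseteq> {1..m} \<longrightarrow> same_order_type x y \<longrightarrow>
         P t (map z x) = P t (map z y))"
      by blast
  qed
qed

section \<open>Embeddings of edge-ordered graphs\<close>

text \<open>Non-edges of \<open>H\<close> are left unconstrained, since containment concerns
  subgraphs that need not be induced.\<close>

definition embeds :: "('b \<Rightarrow> 'a) \<Rightarrow> 'b eograph \<Rightarrow> 'a eograph \<Rightarrow> bool" where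
  "embeds f H G \<longleftrightarrow> inj_on f (verts H) \<and> f ` verts H \<subseteq> verts G \<and>
     (\<forall>e\<in>edges H. f ` e \<in> edges G) \<and>
     (\<forall>d\<in>edges H. \<forall>e\<in>edges H. (d, e) \<in> eord H \<longleftrightarrow> (f ` d, f ` e) \<in> eord G)"

lemma embeds_trans:
  assumes "embeds f H G" "embeds g G K"
  shows "embeds (g \<circ> f) H K"
  using assms unfolding embeds_def image_comp[symmetric]
  by (auto intro!: comp_inj_on intro: inj_on_subset)

lemma simple_graph_edgeE:
  assumes "simple_graph G" "e \<in> edges G"
  obtains u v where "e = {u, v}" "u \<in> verts G" "v \<in> verts G" "u \<noteq> v"
  using assms unfolding simple_graph_def by (meson nsets2_E subsetD)

lemma inj_on_image_edges:
  assumes "simple_graph G" "inj_on f (verts G)"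
  shows "inj_on ((`) f) (edges G)"
  by (rule inj_on_subset[OF inj_on_nsets[OF assms(2), of 2]]) (use assms(1) in \<open>simp add: simple_graph_def\<close>)

text \<open>Inverting the isomorphism from a subgraph onto \<open>H\<close> gives the injection;
  conversely the image of \<open>H\<close> with the restricted order is the subgraph. Since edges
  are pairs of vertices of \<open>H\<close>, mapping them forth and back returns the same
  edges.\<close>

lemma contains_iff_embeds:
  assumes H: "simple_graph H"
  shows "contains G H \<longleftrightarrow> (\<exists>f. embeds f H G)"
proof
  assume "contains G H"
  then obtain S g where S: "eo_subgraph S G" and g: "bij_betw g (verts S) (verts H)"
    and ge: "\<forall>u\<in>verts S. \<forall>v\<in>verts S. {u, v} \<in> edges S \<longleftrightarrow> {g u, g v} \<in> edges H"
    and go: "\<forall>d\<in>edges S. \<forall>e\<in>edges S. (d, e) \<in> eord S \<longleftrightarrow> (g ` d, g ` e) \<in> eord H"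
    unfolding contains_def eo_isomorphic_def by blast
  define f where "f = inv_into (verts S) g"
  have f: "bij_betw f (verts H) (verts S)" unfolding f_def by (rule bij_betw_inv_into[OF g])
  have gf: "g (f u) = u" if "u \<in> verts H" for u
    using g that unfolding f_def by (simp add: bij_betw_inv_into_right)
  have fe: "f ` e \<in> edges S \<and> g ` f ` e = e" if "e \<in> edges H" for e
  proof -
    from H that obtain u v where uv: "e = {u, v}" "u \<in> verts H" "v \<in> verts H"
      by (rule simple_graph_edgeE)
    then have "f u \<in> verts S" "f v \<in> verts S" using f bij_betwE by blast+
    then show ?thesis using ge gf uv that by auto
  qed
  have "embeds f H G"
    unfolding embeds_def
  proof (intro conjI ballI)
    show "inj_on f (verts H)" using f by (simp add: bij_betw_def)
    show "f ` verts H \<subseteq> verts G" using f S by (auto simp: bij_betw_def eo_subgraph_def)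
    show "f ` e \<in> edges G" if "e \<in> edges H" for e
      using fe[OF that] S by (auto simp: eo_subgraph_def)
    show "(d, e) \<in> eord H \<longleftrightarrow> (f ` d, f ` e) \<in> eord G" if "d \<in> edges H" "e \<in> edges H" for d e
    proof -
      have "(d, e) \<in> eord H \<longleftrightarrow> (f ` d, f ` e) \<in> eord S"
        using go fe[OF that(1)] fe[OF that(2)] by metis
      then show ?thesis using S fe[OF that(1)] fe[OF that(2)] by (auto simp: eo_subgraph_def)
    qed
  qed
  then show "\<exists>f. embeds f H G" by blast
next
  assume "\<exists>f. embeds f H G"
  then obtain f where f: "embeds f H G" ..
  define S where "S = \<lparr>verts = f ` verts H, edges = (`) f ` edges H,
    eord = Restr (eord G) ((`) f ` edges H)\<rparr>"
  define g where "g = inv_into (verts H) f"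
  have inj: "inj_on f (verts H)" using f by (simp add: embeds_def)
  have bij: "bij_betw f (verts H) (f ` verts H)" using inj by (simp add: bij_betw_def)
  have gf: "g (f u) = u" if "u \<in> verts H" for u
    using inj that unfolding g_def by simp
  have sub: "e \<subseteq> verts H" if "e \<in> edges H" for e
    using H that by (auto simp: simple_graph_def nsets_def)
  have gfe: "g ` f ` e = e" if "e \<in> edges H" for e
    unfolding g_def by (rule inv_into_image_cancel[OF inj sub[OF that]])
  have "simple_graph S"
  proof -
    have "f ` e \<in> [f ` verts H]\<^bsup>2\<^esup>" if "e \<in> edges H" for e
    proof -
      from H that obtain u v where uv: "e = {u, v}" "u \<in> verts H" "v \<in> verts H" "u \<noteq> v"
        by (rule simple_graph_edgeE)
      then show ?thesis using inj by (auto simp: inj_on_def)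
    qed
    then show ?thesis using H by (auto simp: S_def simple_graph_def)
  qed
  then have "eo_subgraph S G"
    using f by (auto simp: eo_subgraph_def S_def embeds_def)
  moreover have "eo_isomorphic S H"
    unfolding eo_isomorphic_def
  proof (intro exI[of _ g] conjI ballI)
    show "bij_betw g (verts S) (verts H)"
      unfolding S_def g_def using bij_betw_inv_into[OF bij] by simp
    show "{u, v} \<in> edges S \<longleftrightarrow> {g u, g v} \<in> edges H" if uv: "u \<in> verts S" "v \<in> verts S" for u v
    proof -
      obtain a b where ab: "u = f a" "v = f b" "a \<in> verts H" "b \<in> verts H"
        using uv by (auto simp: S_def)
      have "{f a, f b} \<in> (`) f ` edges H \<longleftrightarrow> {a, b} \<in> edges H"
      proof
        assume "{f a, f b} \<in> (`) f ` edges H"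
        then obtain e where e: "e \<in> edges H" "f ` {a, b} = f ` e" by auto
        then have "{a, b} = e"
          using inj_on_image_eq_iff[OF inj] ab sub by (metis empty_subsetI insert_subset)
        then show "{a, b} \<in> edges H" using e by simp
      next
        assume "{a, b} \<in> edges H"
        then have "f ` {a, b} \<in> (`) f ` edges H" by blast
        then show "{f a, f b} \<in> (`) f ` edges H" by simp
      qed
      then show ?thesis using ab gf by (simp add: S_def)
    qed
    show "(d, e) \<in> eord S \<longleftrightarrow> (g ` d, g ` e) \<in> eord H" if "d \<in> edges S" "e \<in> edges S" for d e
      using that gfe f by (auto simp: S_def embeds_def)
  qed
  ultimately show "contains G H" unfolding contains_def by blast
qed

text \<open>A copy of some \<open>H\<close> inside \<open>G\<close> would be carried by
  \<open>f\<close> to a copy inside \<open>K\<close>.\<close>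

lemma avoids_embeds:
  assumes "embeds f G K" "avoids K \<H>" "\<forall>H\<in>\<H>. simple_graph H"
  shows "avoids G \<H>"
  using assms embeds_trans contains_iff_embeds unfolding avoids_def by metis

section \<open>Edge orders as injective labelings\<close>

lemma linear_order_on_labels:
  fixes l :: "'e \<Rightarrow> 'c::linorder"
  assumes "inj_on l E"
  shows "linear_order_on E {(d, e). d \<in> E \<and> e \<in> E \<and> l d \<le> l e}"
  using assms unfolding linear_order_on_def partial_order_on_def preorder_on_def refl_on_def
    trans_def antisym_def total_on_def inj_on_def by fastforce

text \<open>The label counts the elements below or equal in the order. Transitivity makes the count
  monotone, and antisymmetry makes it strictly larger for a strictly later element.\<close>

lemma edge_labelingE:
  fixes E :: "'e set"
  assumes "finite E" "linear_order_on E R"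
  obtains l :: "'e \<Rightarrow> nat" where "inj_on l E"
    "\<And>d e. d \<in> E \<Longrightarrow> e \<in> E \<Longrightarrow> (d, e) \<in> R \<longleftrightarrow> l d \<le> l e"
proof -
  have R: "refl_on E R" "trans R" "antisym R" "total_on E R" "R \<subseteq> E \<times> E"
    using assms(2) unfolding linear_order_on_def partial_order_on_def preorder_on_def by auto
  define l where "l e = card {d. (d, e) \<in> R}" for e
  have fin: "finite {d. (d, e) \<in> R}" for e
    by (rule finite_subset[OF _ assms(1)]) (use R(5) in auto)
  have le: "l d \<le> l e" if "(d, e) \<in> R" for d e
    unfolding l_def by (rule card_mono[OF fin]) (use that R(2) in \<open>auto elim: transE\<close>)
  have less: "l d < l e" if "(d, e) \<in> R" "d \<noteq> e" for d e
    unfolding l_def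
  proof (rule psubset_card_mono[OF fin])
    have "(e, d) \<notin> R" using that R(3) by (auto dest: antisymD)
    moreover have "(e, e) \<in> R" using that R(1,5) by (auto dest: refl_onD)
    ultimately show "{d'. (d', d) \<in> R} \<subset> {d'. (d', e) \<in> R}"
      using that R(2) by (auto elim: transE)
  qed
  have tot: "(d, e) \<in> R \<or> (e, d) \<in> R" if "d \<in> E" "e \<in> E" for d e
    using that R(1,4) by (cases "d = e") (auto dest: refl_onD simp: total_on_def)
  show thesis
  proof (rule that[of l])
    show "inj_on l E" by (rule inj_onI) (metis less less_irrefl tot)
    show "(d, e) \<in> R \<longleftrightarrow> l d \<le> l e" if "d \<in> E" "e \<in> E" for d e
      using le less tot[OF that] by (metis leD)
  qed
qed

text \<open>The order of \<open>K\<close> is pulled back along \<open>f\<close> by labeling an edge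
  of \<open>G\<close> like its image. Distinct edges have distinct images, so the pulled-back order
  is linear, and \<open>f\<close> becomes an embedding of edge-ordered graphs.\<close>

lemma can_avoid_if_embeds:
  assumes G: "simple_graph G" and K: "finite (edges K)" "edge_ordering K (eord K)"
    and f: "inj_on f (verts G)" "f ` verts G \<subseteq> verts K" "\<And>e. e \<in> edges G \<Longrightarrow> f ` e \<in> edges K"
    and av: "avoids K \<H>" "\<forall>H\<in>\<H>. simple_graph H"
  shows "can_avoid G \<H>"
proof -
  obtain l :: "'b set \<Rightarrow> nat" where l: "inj_on l (edges K)"
    "\<And>d e. d \<in> edges K \<Longrightarrow> e \<in> edges K \<Longrightarrow> (d, e) \<in> eord K \<longleftrightarrow> l d \<le> l e"
    using edge_labelingE[OF K(1) K(2)[unfolded edge_ordering_def]] by metis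
  define R where "R = {(d, e). d \<in> edges G \<and> e \<in> edges G \<and> l (f ` d) \<le> l (f ` e)}"
  have "inj_on (\<lambda>e. l (f ` e)) (edges G)"
    using inj_on_image_edges[OF G f(1)] l(1) f(3) by (auto simp: inj_on_def)
  then have "edge_ordering G R"
    unfolding edge_ordering_def R_def by (rule linear_order_on_labels)
  moreover have "embeds f (with_order G R) K"
    using f l(2) by (auto simp: embeds_def with_order_def R_def)
  ultimately show ?thesis
    unfolding can_avoid_def using avoids_embeds[OF _ av] by blast
qed

section \<open>Colourings and attainment of the order chromatic number\<close>

lemma colorable_mono: "colorable G k \<Longrightarrow> k \<le> l \<Longrightarrow> colorable G l"
  unfolding colorable_def by (meson lessThan_subset_iff order_trans)

text \<open>Giving all vertices different colours shows that the set whose least element is taken is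
  nonempty.\<close>

lemma colorable_chromatic_number:
  assumes "simple_graph G"
  shows "colorable G (chromatic_number G)"
proof -
  have fin: "finite (verts G)" using assms by (simp add: simple_graph_def)
  then obtain c :: "'a \<Rightarrow> nat" where c: "bij_betw c (verts G) {0..<card (verts G)}"
    using ex_bij_betw_finite_nat by blast
  have "colorable G (card (verts G))"
    unfolding colorable_def
  proof (intro exI[of _ c] conjI ballI impI)
    show "c ` verts G \<subseteq> {..<card (verts G)}" using c by (auto simp: bij_betw_def)
    fix u v assume uv: "u \<in> verts G" "v \<in> verts G" "{u, v} \<in> edges G"
    then have "{u, v} \<in> [verts G]\<^bsup>2\<^esup>" using assms unfolding simple_graph_def by blast
    then have "u \<noteq> v" by simp
    then show "c u \<noteq> c v" using c uv by (auto simp: bij_betw_def dest: inj_onD)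
  qed
  then show ?thesis unfolding chromatic_number_def by (rule LeastI)
qed

lemma chromatic_number_le: "colorable G k \<Longrightarrow> chromatic_number G \<le> k"
  unfolding chromatic_number_def by (rule Least_le)

lemma order_chromatic_number_le:
  fixes G :: "nat sgraph"
  assumes "simple_graph G" "\<not> can_avoid G \<H>"
  shows "order_chromatic_number \<H> \<le> enat (chromatic_number G)"
  unfolding order_chromatic_number_def by (rule Inf_lower) (use assms in blast)

text \<open>Extended naturals are well-ordered, so the infimum of a nonempty set belongs to it: a
  finite value comes from an actual host.\<close>

lemma order_chromatic_number_attained:
  assumes "order_chromatic_number \<H> \<noteq> \<infinity>"
  obtains G :: "nat sgraph" where "simple_graph G" "\<not> can_avoid G \<H>"
    "order_chromatic_number \<H> = enat (chromatic_number G)"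
proof -
  let ?S = "{enat (chromatic_number G) | G :: nat sgraph. simple_graph G \<and> \<not> can_avoid G \<H>}"
  have "?S \<noteq> {}"
  proof
    assume "?S = {}"
    then show False
      using assms unfolding order_chromatic_number_def by (simp add: Inf_enat_def)
  qed
  then have "Inf ?S \<in> ?S" by (metis (no_types, lifting) Inf_enat_def LeastI ex_in_conv)
  then show thesis using that unfolding order_chromatic_number_def by blast
qed

section \<open>Edge-orderings of complete graphs\<close>

text \<open>A step in the leading term changes the sum by at least \<open>n\<close>, more than the
  trailing terms can compensate. Bounding only their difference also covers the negative trailing
  terms of the inverse labelings.\<close>

lemma lex_le_iff:
  fixes n u v u' v' :: int
  assumes "\<bar>v - v'\<bar> < n"
  shows "n * u + v \<le> n * u' + v' \<longleftrightarrow> u < u' \<or> u = u' \<and> v \<le> v'"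
proof -
  have step: "n * a + v < n * b + v' \<and> n * a + v' < n * b + v" if "a < b" for a b
  proof -
    have "n * (a + 1) \<le> n * b" by (rule mult_left_mono) (use that assms in auto)
    then show ?thesis using assms by (simp add: distrib_left abs_less_iff)
  qed
  show ?thesis
  proof (cases u u' rule: linorder_cases)
    case less then show ?thesis using step[of u u'] by auto
  next
    case greater then show ?thesis using step[of u' u] by auto
  qed auto
qed

lemma labeling_le_iff:
  assumes "1 \<le> i" "i < j" "j \<le> n" "1 \<le> i'" "i' < j'" "j' \<le> n"
  shows "min_labeling n i j \<le> min_labeling n i' j' \<longleftrightarrow> i < i' \<or> i = i' \<and> j \<le> j'"
    and "max_labeling n i j \<le> max_labeling n i' j' \<longleftrightarrow> j < j' \<or> j = j' \<and> i \<le> i'"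
    and "inv_min_labeling n i j \<le> inv_min_labeling n i' j' \<longleftrightarrow> i < i' \<or> i = i' \<and> j' \<le> j"
    and "inv_max_labeling n i j \<le> inv_max_labeling n i' j' \<longleftrightarrow> j < j' \<or> j = j' \<and> i' \<le> i"
proof -
  show "min_labeling n i j \<le> min_labeling n i' j' \<longleftrightarrow> i < i' \<or> i = i' \<and> j \<le> j'"
    unfolding min_labeling_def by (subst lex_le_iff) (use assms in auto)
  show "max_labeling n i j \<le> max_labeling n i' j' \<longleftrightarrow> j < j' \<or> j = j' \<and> i \<le> i'"
    unfolding max_labeling_def by (subst lex_le_iff) (use assms in auto)
  show "inv_min_labeling n i j \<le> inv_min_labeling n i' j' \<longleftrightarrow> i < i' \<or> i = i' \<and> j' \<le> j"
    using lex_le_iff[of "- int j" "- int j'" "int n" "int i" "int i'"] assms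
    unfolding inv_min_labeling_def by auto
  show "inv_max_labeling n i j \<le> inv_max_labeling n i' j' \<longleftrightarrow> j < j' \<or> j = j' \<and> i' \<le> i"
    using lex_le_iff[of "- int i" "- int i'" "int n" "int j" "int j'"] assms
    unfolding inv_max_labeling_def by auto
qed

text \<open>The lexicographic descriptions in \<open>labeling_le_iff\<close> do not mention
  \<open>n\<close>, so the comparison survives a change of size.\<close>

lemma canonical_labeling_le_iff_le:
  assumes "L \<in> canonical_labelings" "1 \<le> i" "i < j" "j \<le> m" "1 \<le> i'" "i' < j'" "j' \<le> m" "m \<le> n"
  shows "L m i j \<le> L m i' j' \<longleftrightarrow> L n i j \<le> L n i' j'"
  using assms by (auto simp: canonical_labelings_def labeling_le_iff)

lemma canonical_labeling_inj:
  assumes "L \<in> canonical_labelings" "1 \<le> i" "i < j" "j \<le> n" "1 \<le> i'" "i' < j'" "j' \<le> n"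
    "L n i j = L n i' j'"
  shows "i = i' \<and> j = j'"
proof -
  have "L n i j \<le> L n i' j' \<and> L n i' j' \<le> L n i j" using assms(8) by simp
  then show ?thesis
    using assms(1) unfolding canonical_labelings_def
    by (elim insertE emptyE)
      (use assms(2-7) in \<open>simp only: labeling_le_iff, linarith\<close>)+
qed

lemma simple_graph_complete_graph: "simple_graph (complete_graph n)"
  by (simp add: simple_graph_def complete_graph_def)

lemma complete_graph_edgeE:
  assumes "e \<in> edges (complete_graph n)"
  obtains i j where "e = {i, j}" "1 \<le> i" "i < j" "j \<le> n"
  using assms by (auto simp: complete_graph_def ordered_nsets_2_eq)

lemma verts_labeled_complete_graph [simp]: "verts (labeled_complete_graph L n) = {1..n}"
  and edges_labeled_complete_graph [simp]:
    "edges (labeled_complete_graph L n) = edges (complete_graph n)"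
  by (simp_all add: labeled_complete_graph_def with_order_def complete_graph_def)

lemma labeled_complete_graph_eord:
  assumes "1 \<le> i" "i < j" "j \<le> n" "1 \<le> i'" "i' < j'" "j' \<le> n"
  shows "({i, j}, {i', j'}) \<in> eord (labeled_complete_graph L n) \<longleftrightarrow> L n i j \<le> L n i' j'"
  using assms by (simp add: labeled_complete_graph_def with_order_def complete_graph_def min_def max_def)

lemma edge_ordering_labeled_complete_graph:
  assumes "L \<in> canonical_labelings"
  shows "edge_ordering (labeled_complete_graph L n) (eord (labeled_complete_graph L n))"
proof -
  have "inj_on (\<lambda>e. L n (Min e) (Max e)) (edges (complete_graph n))"
  proof (rule inj_onI)
    fix d e assume d: "d \<in> edges (complete_graph n)" and e: "e \<in> edges (complete_graph n)"
      and eq: "L n (Min d) (Max d) = L n (Min e) (Max e)"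
    from d obtain i j where d': "d = {i, j}" "1 \<le> i" "i < j" "j \<le> n"
      by (rule complete_graph_edgeE)
    from e obtain i' j' where e': "e = {i', j'}" "1 \<le> i'" "i' < j'" "j' \<le> n"
      by (rule complete_graph_edgeE)
    have "L n i j = L n i' j'" using eq d' e' by (simp add: min_def max_def)
    then show "d = e" using canonical_labeling_inj[OF assms d'(2-4) e'(2-4)] d' e' by simp
  qed
  from linear_order_on_labels[OF this] show ?thesis
    by (simp add: edge_ordering_def labeled_complete_graph_def with_order_def)
qed

text \<open>This nesting lets failures of the four labelings at different sizes be moved to one
  common size.\<close>

lemma embeds_labeled_complete_graph_mono:
  assumes "L \<in> canonical_labelings" "m \<le> n"
  shows "embeds id (labeled_complete_graph L m) (labeled_complete_graph L n)"
  unfolding embeds_def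
proof (intro conjI ballI)
  fix e assume "e \<in> edges (labeled_complete_graph L m)"
  then show "id ` e \<in> edges (labeled_complete_graph L n)"
    using assms(2) by (auto elim!: complete_graph_edgeE) (auto simp: complete_graph_def)
next
  fix d e assume d: "d \<in> edges (labeled_complete_graph L m)"
    and e: "e \<in> edges (labeled_complete_graph L m)"
  from d obtain i j where d': "d = {i, j}" "1 \<le> i" "i < j" "j \<le> m"
    by (auto elim: complete_graph_edgeE)
  from e obtain i' j' where e': "e = {i', j'}" "1 \<le> i'" "i' < j'" "j' \<le> m"
    by (auto elim: complete_graph_edgeE)
  show "(d, e) \<in> eord (labeled_complete_graph L m) \<longleftrightarrow>
      (id ` d, id ` e) \<in> eord (labeled_complete_graph L n)"
    using canonical_labeling_le_iff_le[OF assms(1) d'(2-4) e'(2-4) assms(2)] d' e' assms(2)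
    by (simp add: labeled_complete_graph_eord)
qed (use assms in auto)

section \<open>From comparison patterns to canonical labelings\<close>

text \<open>Edges with four distinct endpoints are compared through an intermediate edge sharing a
  vertex with each. This fails only when the triples read ab < ac < bc and the edges are nested: ad
  and bc are then not linked, and their comparison separates min from max. The other two triple
  patterns give inverse min and inverse max. The conclusion is an implication between strict
  inequalities; since labels of distinct edges differ on the canonical side, it already fixes the
  whole order.\<close>

lemma canonical_of_triples:
  fixes f :: "nat \<Rightarrow> nat \<Rightarrow> nat"
  assumes "(\<forall>a b c. 1 \<le> a \<and> a < b \<and> b < c \<and> c \<le> n \<longrightarrow> f a b < f a c \<and> f a c < f b c) \<and>
       ((\<forall>a b c d. 1 \<le> a \<and> a < b \<and> b < c \<and> c < d \<and> d \<le> n \<longrightarrow> f a d < f b c) \<or>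
        (\<forall>a b c d. 1 \<le> a \<and> a < b \<and> b < c \<and> c < d \<and> d \<le> n \<longrightarrow> f b c < f a d)) \<or>
     (\<forall>a b c. 1 \<le> a \<and> a < b \<and> b < c \<and> c \<le> n \<longrightarrow> f a c < f a b \<and> f a b < f b c) \<or>
     (\<forall>a b c. 1 \<le> a \<and> a < b \<and> b < c \<and> c \<le> n \<longrightarrow> f a b < f b c \<and> f b c < f a c)"
  shows "\<exists>L\<in>canonical_labelings. \<forall>i j i' j'. 1 \<le> i \<and> i < j \<and> j \<le> n \<and> 1 \<le> i' \<and> i' < j' \<and> j' \<le> n \<longrightarrow>
     L n i j < L n i' j' \<longrightarrow> f i j < f i' j'"
  using assms
proof (elim disjE conjE)
  assume T: "\<forall>a b c. 1 \<le> a \<and> a < b \<and> b < c \<and> c \<le> n \<longrightarrow> f a b < f a c \<and> f a c < f b c"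
    and Z: "\<forall>a b c d. 1 \<le> a \<and> a < b \<and> b < c \<and> c < d \<and> d \<le> n \<longrightarrow> f a d < f b c"
  have "f i j < f i' j'"
    if h: "1 \<le> i" "i < j" "j \<le> n" "1 \<le> i'" "i' < j'" "j' \<le> n"
      "min_labeling n i j < min_labeling n i' j'" for i j i' j'
  proof -
    have "i < i' \<or> i = i' \<and> j < j'" using h labeling_le_iff(1)[of i' j' n i j] by auto
    then consider "i = i'" "j < j'" | "i < i'" "j < j'" | "i < i'" "j = j'" | "i < i'" "j' < j"
      by linarith
    then show ?thesis
    proof cases
      case 2
      then have "f i j < f i j'" "f i j' < f i' j'" using h T by auto
      then show ?thesis by simp
    qed (use h T Z in auto)
  qed
  then show ?thesis by (intro bexI[of _ min_labeling]) (auto simp: canonical_labelings_def)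
next
  assume T: "\<forall>a b c. 1 \<le> a \<and> a < b \<and> b < c \<and> c \<le> n \<longrightarrow> f a b < f a c \<and> f a c < f b c"
    and Z: "\<forall>a b c d. 1 \<le> a \<and> a < b \<and> b < c \<and> c < d \<and> d \<le> n \<longrightarrow> f b c < f a d"
  have "f i j < f i' j'"
    if h: "1 \<le> i" "i < j" "j \<le> n" "1 \<le> i'" "i' < j'" "j' \<le> n"
      "max_labeling n i j < max_labeling n i' j'" for i j i' j'
  proof -
    have "j < j' \<or> j = j' \<and> i < i'" using h labeling_le_iff(2)[of i' j' n i j] by auto
    then consider "j = j'" "i < i'" | "j < j'" "i < i'" | "j < j'" "i = i'" | "j < j'" "i' < i"
      by linarith
    then show ?thesis
    proof cases
      case 2
      then have "f i j < f i j'" "f i j' < f i' j'" using h T by auto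
      then show ?thesis by simp
    qed (use h T Z in auto)
  qed
  then show ?thesis by (intro bexI[of _ max_labeling]) (auto simp: canonical_labelings_def)
next
  assume T: "\<forall>a b c. 1 \<le> a \<and> a < b \<and> b < c \<and> c \<le> n \<longrightarrow> f a c < f a b \<and> f a b < f b c"
  have "f i j < f i' j'"
    if h: "1 \<le> i" "i < j" "j \<le> n" "1 \<le> i'" "i' < j'" "j' \<le> n"
      "inv_min_labeling n i j < inv_min_labeling n i' j'" for i j i' j'
  proof -
    have "i < i' \<or> i = i' \<and> j' < j" using h labeling_le_iff(3)[of i' j' n i j] by auto
    then consider "i = i'" "j' < j" | "i < i'" "j < i'" | "i < i'" "j = i'" | "i < i'" "i' < j"
      by linarith
    then show ?thesis
    proof cases
      case 2
      then have "f i j < f j i'" "f j i' < f i' j'" using h T by auto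
      then show ?thesis by simp
    next
      case 4
      then have "f i j < f i i'" "f i i' < f i' j'" using h T by auto
      then show ?thesis by simp
    qed (use h T in auto)
  qed
  then show ?thesis by (intro bexI[of _ inv_min_labeling]) (auto simp: canonical_labelings_def)
next
  assume T: "\<forall>a b c. 1 \<le> a \<and> a < b \<and> b < c \<and> c \<le> n \<longrightarrow> f a b < f b c \<and> f b c < f a c"
  have "f i j < f i' j'"
    if h: "1 \<le> i" "i < j" "j \<le> n" "1 \<le> i'" "i' < j'" "j' \<le> n"
      "inv_max_labeling n i j < inv_max_labeling n i' j'" for i j i' j'
  proof -
    have "j < j' \<or> j = j' \<and> i' < i" using h labeling_le_iff(4)[of i' j' n i j] by auto
    then consider "j = j'" "i' < i" | "j < j'" "j < i'" | "j < j'" "j = i'" | "j < j'" "i' < j"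
      by linarith
    then show ?thesis
    proof cases
      case 2
      then have "f i j < f j i'" "f j i' < f i' j'" using h T by auto
      then show ?thesis by simp
    next
      case 4
      then have "f i j < f j j'" "f j j' < f i' j'" using h T by auto
      then show ?thesis by simp
    qed (use h T in auto)
  qed
  then show ?thesis by (intro bexI[of _ inv_max_labeling]) (auto simp: canonical_labelings_def)
qed

lemma same_order_type_four:
  "same_order_type [a, b, c, d] [a', b', c', d'] \<longleftrightarrow>
     (a < b \<longleftrightarrow> a' < b') \<and> (a < c \<longleftrightarrow> a' < c') \<and> (a < d \<longleftrightarrow> a' < d') \<and>
     (b < a \<longleftrightarrow> b' < a') \<and> (b < c \<longleftrightarrow> b' < c') \<and> (b < d \<longleftrightarrow> b' < d') \<and>
     (c < a \<longleftrightarrow> c' < a') \<and> (c < b \<longleftrightarrow> c' < b') \<and> (c < d \<longleftrightarrow> c' < d') \<and>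
     (d < a \<longleftrightarrow> d' < a') \<and> (d < b \<longleftrightarrow> d' < b') \<and> (d < c \<longleftrightarrow> d' < c')"
  by (auto simp: same_order_type_def All_less_Suc2)

text \<open>Invariance makes the truth value of the comparison constant on \<open>D\<close>, and the
  absence of ties makes it strict. The index type is arbitrary so that tuples of any length can
  serve as \<open>p\<close>.\<close>

lemma comparison_dichotomy:
  fixes F G :: "'p \<Rightarrow> 'c::linorder"
  assumes "\<And>p q. D p \<Longrightarrow> D q \<Longrightarrow> F p \<le> G p \<longleftrightarrow> F q \<le> G q" "\<And>p. D p \<Longrightarrow> F p \<noteq> G p"
  shows "(\<forall>p. D p \<longrightarrow> F p < G p) \<or> (\<forall>p. D p \<longrightarrow> G p < F p)"
proof (cases "\<exists>p. D p \<and> F p \<le> G p")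
  case True
  then have "F q \<le> G q \<and> F q \<noteq> G q" if "D q" for q using assms that by blast
  then show ?thesis by (simp add: less_le)
next
  case False
  then show ?thesis by (auto simp: not_le)
qed

text \<open>
  The eight order-invariant patterns split into four pairs exchanged by reversing the vertices, and
  each canonical labeling realises one pattern of a pair.
\<close>

lemma canonical_of_order_invariant:
  fixes f :: "nat \<Rightarrow> nat \<Rightarrow> nat"
  assumes inv: "\<And>a b c d a' b' c' d'. {a, b, c, d, a', b', c', d'} \<subseteq> {1..n} \<Longrightarrow>
      same_order_type [a, b, c, d] [a', b', c', d'] \<Longrightarrow> f a b \<le> f c d \<longleftrightarrow> f a' b' \<le> f c' d'"
    and inj: "\<And>a b c d. 1 \<le> a \<Longrightarrow> a < b \<Longrightarrow> b \<le> n \<Longrightarrow> 1 \<le> c \<Longrightarrow> c < d \<Longrightarrow> d \<le> n \<Longrightarrow>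
      f a b = f c d \<Longrightarrow> a = c \<and> b = d"
    and sym: "\<And>a b. f a b = f b a"
  obtains L g where "L \<in> canonical_labelings" "inj_on g {1..n}" "g ` {1..n} \<subseteq> {1..n}"
    "\<And>i j i' j'. 1 \<le> i \<Longrightarrow> i < j \<Longrightarrow> j \<le> n \<Longrightarrow> 1 \<le> i' \<Longrightarrow> i' < j' \<Longrightarrow> j' \<le> n \<Longrightarrow>
       L n i j < L n i' j' \<Longrightarrow> f (g i) (g j) < f (g i') (g j')"
proof -
  have dich3: "(\<forall>a b c. 1 \<le> a \<and> a < b \<and> b < c \<and> c \<le> n \<longrightarrow> F a b c < G a b c) \<or>
      (\<forall>a b c. 1 \<le> a \<and> a < b \<and> b < c \<and> c \<le> n \<longrightarrow> G a b c < F a b c)"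
    if "\<And>a b c a' b' c'. 1 \<le> a \<Longrightarrow> a < b \<Longrightarrow> b < c \<Longrightarrow> c \<le> n \<Longrightarrow> 1 \<le> a' \<Longrightarrow> a' < b' \<Longrightarrow> b' < c' \<Longrightarrow>
      c' \<le> n \<Longrightarrow> F a b c \<le> G a b c \<longleftrightarrow> F a' b' c' \<le> G a' b' c'"
      "\<And>a b c. 1 \<le> a \<Longrightarrow> a < b \<Longrightarrow> b < c \<Longrightarrow> c \<le> n \<Longrightarrow> F a b c \<noteq> G a b c"
    for F G :: "nat \<Rightarrow> nat \<Rightarrow> nat \<Rightarrow> nat"
    using comparison_dichotomy[of "\<lambda>(a, b, c). 1 \<le> a \<and> a < b \<and> b < c \<and> c \<le> n"
        "\<lambda>(a, b, c). F a b c" "\<lambda>(a, b, c). G a b c"] that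
    by (simp add: split_paired_all)
  have A: "(\<forall>a b c. 1 \<le> a \<and> a < b \<and> b < c \<and> c \<le> n \<longrightarrow> f a b < f a c) \<or>
      (\<forall>a b c. 1 \<le> a \<and> a < b \<and> b < c \<and> c \<le> n \<longrightarrow> f a c < f a b)"
  proof (rule dich3[of "\<lambda>a b c. f a b" "\<lambda>a b c. f a c"])
    show "f a b \<le> f a c \<longleftrightarrow> f a' b' \<le> f a' c'"
      if "1 \<le> a" "a < b" "b < c" "c \<le> n" "1 \<le> a'" "a' < b'" "b' < c'" "c' \<le> n" for a b c a' b' c'
      by (rule inv) (use that in \<open>auto simp: same_order_type_four\<close>)
    show "f a b \<noteq> f a c" if "1 \<le> a" "a < b" "b < c" "c \<le> n" for a b c
      using inj[of a b a c] that by auto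
  qed
  have B: "(\<forall>a b c. 1 \<le> a \<and> a < b \<and> b < c \<and> c \<le> n \<longrightarrow> f a c < f b c) \<or>
      (\<forall>a b c. 1 \<le> a \<and> a < b \<and> b < c \<and> c \<le> n \<longrightarrow> f b c < f a c)"
  proof (rule dich3[of "\<lambda>a b c. f a c" "\<lambda>a b c. f b c"])
    show "f a c \<le> f b c \<longleftrightarrow> f a' c' \<le> f b' c'"
      if "1 \<le> a" "a < b" "b < c" "c \<le> n" "1 \<le> a'" "a' < b'" "b' < c'" "c' \<le> n" for a b c a' b' c'
      by (rule inv) (use that in \<open>auto simp: same_order_type_four\<close>)
    show "f a c \<noteq> f b c" if "1 \<le> a" "a < b" "b < c" "c \<le> n" for a b c
      using inj[of a c b c] that by auto
  qed
  have C: "(\<forall>a b c. 1 \<le> a \<and> a < b \<and> b < c \<and> c \<le> n \<longrightarrow> f a b < f b c) \<or>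
      (\<forall>a b c. 1 \<le> a \<and> a < b \<and> b < c \<and> c \<le> n \<longrightarrow> f b c < f a b)"
  proof (rule dich3[of "\<lambda>a b c. f a b" "\<lambda>a b c. f b c"])
    show "f a b \<le> f b c \<longleftrightarrow> f a' b' \<le> f b' c'"
      if "1 \<le> a" "a < b" "b < c" "c \<le> n" "1 \<le> a'" "a' < b'" "b' < c'" "c' \<le> n" for a b c a' b' c'
      by (rule inv) (use that in \<open>auto simp: same_order_type_four\<close>)
    show "f a b \<noteq> f b c" if "1 \<le> a" "a < b" "b < c" "c \<le> n" for a b c
      using inj[of a b b c] that by auto
  qed
  have Z: "(\<forall>a b c d. 1 \<le> a \<and> a < b \<and> b < c \<and> c < d \<and> d \<le> n \<longrightarrow> f a d < f b c) \<or>
      (\<forall>a b c d. 1 \<le> a \<and> a < b \<and> b < c \<and> c < d \<and> d \<le> n \<longrightarrow> f b c < f a d)"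
  proof -
    have "f a d \<le> f b c \<longleftrightarrow> f a' d' \<le> f b' c'"
      if "1 \<le> a" "a < b" "b < c" "c < d" "d \<le> n" "1 \<le> a'" "a' < b'" "b' < c'" "c' < d'" "d' \<le> n"
      for a b c d a' b' c' d'
      by (rule inv) (use that in \<open>auto simp: same_order_type_four\<close>)
    moreover have "f a d \<noteq> f b c" if "1 \<le> a" "a < b" "b < c" "c < d" "d \<le> n" for a b c d
      using inj[of a d b c] that by auto
    ultimately show ?thesis
      using comparison_dichotomy[of "\<lambda>(a, b, c, d). 1 \<le> a \<and> a < b \<and> b < c \<and> c < d \<and> d \<le> n"
          "\<lambda>(a, b, c, d). f a d" "\<lambda>(a, b, c, d). f b c"]
      by (simp add: split_paired_all)
  qed
  \<comment> \<open>Reversal sends \<open>i\<close> to \<open>n + 1 - i\<close>; the arguments are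
    exchanged so that increasing pairs come from increasing pairs.\<close>
  define h where "h a b = f (n + 1 - b) (n + 1 - a)" for a b
  define pat where "pat F \<longleftrightarrow>
     (\<forall>a b c. 1 \<le> a \<and> a < b \<and> b < c \<and> c \<le> n \<longrightarrow> F a b < F a c \<and> F a c < F b c) \<and>
       ((\<forall>a b c d. 1 \<le> a \<and> a < b \<and> b < c \<and> c < d \<and> d \<le> n \<longrightarrow> F a d < F b c) \<or>
        (\<forall>a b c d. 1 \<le> a \<and> a < b \<and> b < c \<and> c < d \<and> d \<le> n \<longrightarrow> F b c < F a d)) \<or>
     (\<forall>a b c. 1 \<le> a \<and> a < b \<and> b < c \<and> c \<le> n \<longrightarrow> F a c < F a b \<and> F a b < F b c) \<or>
     (\<forall>a b c. 1 \<le> a \<and> a < b \<and> b < c \<and> c \<le> n \<longrightarrow> F a b < F b c \<and> F b c < F a c)"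
    for F :: "nat \<Rightarrow> nat \<Rightarrow> nat"
  have rev: "1 \<le> n + 1 - c \<and> n + 1 - c < n + 1 - b \<and> n + 1 - b < n + 1 - a \<and> n + 1 - a \<le> n"
    if "1 \<le> a" "a < b" "b < c" "c \<le> n" for a b c
    using that by auto
  \<comment> \<open>If ab < ac and ac < bc are both true or both false, transitivity fixes ab
    against bc and the nested comparison stays free. If exactly one is true, ab against bc stays
    free and the triples settle the rest. Each of the four combinations thus leaves one binary
    choice, eight patterns in all.\<close>
  have "pat f \<or> pat h"
  proof (cases "\<forall>a b c. 1 \<le> a \<and> a < b \<and> b < c \<and> c \<le> n \<longrightarrow> f a b < f a c")
    case A1: True
    show ?thesis
    proof (cases "\<forall>a b c. 1 \<le> a \<and> a < b \<and> b < c \<and> c \<le> n \<longrightarrow> f a c < f b c")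
      case True
      then have "pat f" unfolding pat_def using A1 Z by blast
      then show ?thesis ..
    next
      case False
      then have B2: "\<forall>a b c. 1 \<le> a \<and> a < b \<and> b < c \<and> c \<le> n \<longrightarrow> f b c < f a c" using B by blast
      from C show ?thesis
      proof
        assume "\<forall>a b c. 1 \<le> a \<and> a < b \<and> b < c \<and> c \<le> n \<longrightarrow> f a b < f b c"
        then have "pat f" unfolding pat_def using B2 by blast
        then show ?thesis ..
      next
        assume C2: "\<forall>a b c. 1 \<le> a \<and> a < b \<and> b < c \<and> c \<le> n \<longrightarrow> f b c < f a b"
        have "h a b < h b c \<and> h b c < h a c" if "1 \<le> a" "a < b" "b < c" "c \<le> n" for a b c
          unfolding h_def using A1[rule_format, OF rev[OF that]] C2[rule_format, OF rev[OF that]] by simp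
        then have "pat h" unfolding pat_def by blast
        then show ?thesis ..
      qed
    qed
  next
    case False
    then have A2: "\<forall>a b c. 1 \<le> a \<and> a < b \<and> b < c \<and> c \<le> n \<longrightarrow> f a c < f a b" using A by blast
    show ?thesis
    proof (cases "\<forall>a b c. 1 \<le> a \<and> a < b \<and> b < c \<and> c \<le> n \<longrightarrow> f a c < f b c")
      case B1: True
      from C show ?thesis
      proof
        assume "\<forall>a b c. 1 \<le> a \<and> a < b \<and> b < c \<and> c \<le> n \<longrightarrow> f a b < f b c"
        then have "pat f" unfolding pat_def using A2 by blast
        then show ?thesis ..
      next
        assume C2: "\<forall>a b c. 1 \<le> a \<and> a < b \<and> b < c \<and> c \<le> n \<longrightarrow> f b c < f a b"
        have "h a c < h a b \<and> h a b < h b c" if "1 \<le> a" "a < b" "b < c" "c \<le> n" for a b c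
          unfolding h_def using B1[rule_format, OF rev[OF that]] C2[rule_format, OF rev[OF that]] by simp
        then have "pat h" unfolding pat_def by blast
        then show ?thesis ..
      qed
    next
      case False
      then have B2: "\<forall>a b c. 1 \<le> a \<and> a < b \<and> b < c \<and> c \<le> n \<longrightarrow> f b c < f a c" using B by blast
      have T: "h a b < h a c \<and> h a c < h b c" if "1 \<le> a" "a < b" "b < c" "c \<le> n" for a b c
        unfolding h_def using A2[rule_format, OF rev[OF that]] B2[rule_format, OF rev[OF that]] by simp
      from Z have "(\<forall>a b c d. 1 \<le> a \<and> a < b \<and> b < c \<and> c < d \<and> d \<le> n \<longrightarrow> h a d < h b c) \<or>
        (\<forall>a b c d. 1 \<le> a \<and> a < b \<and> b < c \<and> c < d \<and> d \<le> n \<longrightarrow> h b c < h a d)"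
      proof
        assume Z1: "\<forall>a b c d. 1 \<le> a \<and> a < b \<and> b < c \<and> c < d \<and> d \<le> n \<longrightarrow> f a d < f b c"
        have "h a d < h b c" if "1 \<le> a" "a < b" "b < c" "c < d" "d \<le> n" for a b c d
          unfolding h_def by (rule Z1[rule_format]) (use that in auto)
        then show ?thesis by blast
      next
        assume Z2: "\<forall>a b c d. 1 \<le> a \<and> a < b \<and> b < c \<and> c < d \<and> d \<le> n \<longrightarrow> f b c < f a d"
        have "h b c < h a d" if "1 \<le> a" "a < b" "b < c" "c < d" "d \<le> n" for a b c d
          unfolding h_def by (rule Z2[rule_format]) (use that in auto)
        then show ?thesis by blast
      qed
      then have "pat h" unfolding pat_def using T by blast
      then show ?thesis ..
    qed
  qed
  then show thesis
  proof
    assume "pat f"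
    then obtain L where "L \<in> canonical_labelings"
      "\<forall>i j i' j'. 1 \<le> i \<and> i < j \<and> j \<le> n \<and> 1 \<le> i' \<and> i' < j' \<and> j' \<le> n \<longrightarrow>
        L n i j < L n i' j' \<longrightarrow> f i j < f i' j'"
      unfolding pat_def using canonical_of_triples[of n f] by blast
    then show thesis using that[of L "\<lambda>i. i"] by auto
  next
    assume "pat h"
    then obtain L where L: "L \<in> canonical_labelings"
      "\<forall>i j i' j'. 1 \<le> i \<and> i < j \<and> j \<le> n \<and> 1 \<le> i' \<and> i' < j' \<and> j' \<le> n \<longrightarrow>
        L n i j < L n i' j' \<longrightarrow> h i j < h i' j'"
      unfolding pat_def using canonical_of_triples[of n h] by blast
    show thesis
    proof (rule that[of L "\<lambda>i. n + 1 - i"])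
      show "inj_on (\<lambda>i. n + 1 - i) {1..n}" by (auto simp: inj_on_def)
      show "f (n + 1 - i) (n + 1 - j) < f (n + 1 - i') (n + 1 - j')"
        if "1 \<le> i" "i < j" "j \<le> n" "1 \<le> i'" "i' < j'" "j' \<le> n" "L n i j < L n i' j'" for i j i' j'
      proof -
        \<comment> \<open>By symmetry of \<open>f\<close> the exchange of arguments in
          \<open>h\<close> disappears, leaving only the reversed vertices.\<close>
        have "h i j < h i' j'" using L(2) that by blast
        then show ?thesis unfolding h_def using sym by metis
      qed
    qed (use L in auto)
  qed
qed

text \<open>\<open>N\<close> depends on \<open>n\<close> alone, while the labeling may depend on the
  given order. There are no classes to keep track of, so a one-element set of tags is
  enough.\<close>

lemma ramsey_complete_graph:
  obtains N :: nat where "\<And>R. edge_ordering (complete_graph N) R \<Longrightarrow>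
    \<exists>L\<in>canonical_labelings. \<exists>f. embeds f (labeled_complete_graph L n) (with_order (complete_graph N) R)"
proof -
  obtain N :: nat where N: "\<And>P :: unit \<Rightarrow> nat list \<Rightarrow> bool.
     \<exists>z. strict_mono_on {1..n} z \<and> z ` {1..n} \<subseteq> {1..N} \<and>
      (\<forall>t\<in>UNIV. \<forall>x y. length x = 4 \<longrightarrow> set x \<union> set y \<subseteq> {1..n} \<longrightarrow> same_order_type x y \<longrightarrow>
         P t (map z x) = P t (map z y))"
    using ramsey_order_type[of "UNIV :: unit set"] by (metis finite)
  show thesis
  proof (rule that[of N])
    fix R assume R: "edge_ordering (complete_graph N) R"
    have fin: "finite (edges (complete_graph N))"
      by (simp add: complete_graph_def finite_imp_finite_nsets)
    obtain l :: "nat set \<Rightarrow> nat" where l: "inj_on l (edges (complete_graph N))"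
      "\<And>d e. d \<in> edges (complete_graph N) \<Longrightarrow> e \<in> edges (complete_graph N) \<Longrightarrow>
         (d, e) \<in> R \<longleftrightarrow> l d \<le> l e"
      using edge_labelingE[OF fin R[unfolded edge_ordering_def]] by metis
    \<comment> \<open>For repeated entries such as \<open>x ! 0 = x ! 1\<close> the set is a
      singleton with an arbitrary label. Homogeneity holds there as well, and the embedding only
      compares genuine edges.\<close>
    define P where "P = (\<lambda>(_::unit) x. l {x ! 0, x ! 1 :: nat} \<le> l {x ! 2, x ! 3})"
    obtain z where z: "strict_mono_on {1..n} z" "z ` {1..n} \<subseteq> {1..N}"
      and hom: "\<And>x y. length x = 4 \<Longrightarrow> set x \<union> set y \<subseteq> {1..n} \<Longrightarrow> same_order_type x y \<Longrightarrow>
         P () (map z x) = P () (map z y)"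
    proof -
      obtain z where "strict_mono_on {1..n} z \<and> z ` {1..n} \<subseteq> {1..N} \<and>
        (\<forall>t\<in>UNIV. \<forall>x y. length x = 4 \<longrightarrow> set x \<union> set y \<subseteq> {1..n} \<longrightarrow> same_order_type x y \<longrightarrow>
          P t (map z x) = P t (map z y))"
        using N[of P] by (elim exE)
      then show thesis by (intro that[of z]) auto
    qed
    have injz: "inj_on z {1..n}" using z(1) by (rule strict_mono_on_imp_inj_on)
    have edge: "{z a, z b} \<in> edges (complete_graph N)" if "a \<in> {1..n}" "b \<in> {1..n}" "a \<noteq> b" for a b
    proof -
      have "z a \<in> {1..N}" "z b \<in> {1..N}" using that z(2) by blast+
      moreover have "z a \<noteq> z b" using that injz by (auto dest: inj_onD)
      ultimately show ?thesis by (simp add: complete_graph_def)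
    qed
    obtain L g where L: "L \<in> canonical_labelings" and g: "inj_on g {1..n}" "g ` {1..n} \<subseteq> {1..n}"
      and less: "\<And>i j i' j'. 1 \<le> i \<Longrightarrow> i < j \<Longrightarrow> j \<le> n \<Longrightarrow> 1 \<le> i' \<Longrightarrow> i' < j' \<Longrightarrow> j' \<le> n \<Longrightarrow>
        L n i j < L n i' j' \<Longrightarrow> l {z (g i), z (g j)} < l {z (g i'), z (g j')}"
    proof (rule canonical_of_order_invariant[of n "\<lambda>a b. l {z a, z b}"])
      show "l {z a, z b} \<le> l {z c, z d} \<longleftrightarrow> l {z a', z b'} \<le> l {z c', z d'}"
        if "{a, b, c, d, a', b', c', d'} \<subseteq> {1..n}" "same_order_type [a, b, c, d] [a', b', c', d']"
        for a b c d a' b' c' d'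
        using hom[of "[a, b, c, d]" "[a', b', c', d']"] that by (simp add: P_def numeral_eq_Suc)
      show "a = c \<and> b = d"
        if "1 \<le> a" "a < b" "b \<le> n" "1 \<le> c" "c < d" "d \<le> n" "l {z a, z b} = l {z c, z d}" for a b c d
      proof -
        have "z ` {a, b} = z ` {c, d}"
          using inj_onD[OF l(1) that(7)] edge[of a b] edge[of c d] that by auto
        then have "{a, b} = {c, d}"
          by (subst (asm) inj_on_image_eq_iff[OF injz]) (use that in auto)
        then show ?thesis using that by (auto simp: doubleton_eq_iff)
      qed
      show "l {z a, z b} = l {z b, z a}" for a b by (simp add: insert_commute)
    qed (rule that)
    have g': "g i \<in> {1..n} \<and> g j \<in> {1..n} \<and> g i \<noteq> g j" if "1 \<le> i" "i < j" "j \<le> n" for i j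
    proof -
      have ij: "i \<in> {1..n}" "j \<in> {1..n}" "i \<noteq> j" using that by auto
      then have "g i \<noteq> g j" using g(1) by (meson inj_onD)
      then show ?thesis using g(2) ij by blast
    qed
    have "embeds (z \<circ> g) (labeled_complete_graph L n) (with_order (complete_graph N) R)"
      unfolding embeds_def
    proof (intro conjI ballI)
      show "inj_on (z \<circ> g) (verts (labeled_complete_graph L n))"
        using comp_inj_on[OF g(1) inj_on_subset[OF injz g(2)]] by simp
      show "(z \<circ> g) ` verts (labeled_complete_graph L n) \<subseteq> verts (with_order (complete_graph N) R)"
        using z(2) g(2) by (auto simp: with_order_def complete_graph_def image_subset_iff)
      fix d assume "d \<in> edges (labeled_complete_graph L n)"
      then obtain i j where d: "d = {i, j}" "1 \<le> i" "i < j" "j \<le> n"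
        by (auto elim: complete_graph_edgeE)
      show dE: "(z \<circ> g) ` d \<in> edges (with_order (complete_graph N) R)"
        using edge[of "g i" "g j"] g'[OF d(2-4)] d(1) by (simp add: with_order_def)
      fix e assume "e \<in> edges (labeled_complete_graph L n)"
      then obtain i' j' where e: "e = {i', j'}" "1 \<le> i'" "i' < j'" "j' \<le> n"
        by (auto elim: complete_graph_edgeE)
      have eE: "(z \<circ> g) ` e \<in> edges (with_order (complete_graph N) R)"
        using edge[of "g i'" "g j'"] g'[OF e(2-4)] e(1) by (simp add: with_order_def)
      \<comment> \<open>Trichotomy of the canonical labels upgrades the strict implication: a
        reversed comparison is also preserved, and equal labels mean the same edge.\<close>
      have "L n i j \<le> L n i' j' \<longleftrightarrow> l {z (g i), z (g j)} \<le> l {z (g i'), z (g j')}"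
        using less[OF d(2-4) e(2-4)] less[OF e(2-4) d(2-4)]
          canonical_labeling_inj[OF L d(2-4) e(2-4)]
        by (cases "L n i j" "L n i' j'" rule: linorder_cases) auto
      then show "(d, e) \<in> eord (labeled_complete_graph L n) \<longleftrightarrow>
          ((z \<circ> g) ` d, (z \<circ> g) ` e) \<in> eord (with_order (complete_graph N) R)"
        using l(2) dE eE d e by (simp add: labeled_complete_graph_eord with_order_def)
    qed
    then show "\<exists>L\<in>canonical_labelings. \<exists>f.
        embeds f (labeled_complete_graph L n) (with_order (complete_graph N) R)"
      using L by blast
  qed
qed

section \<open>Edge-orderings of complete multipartite graphs\<close>

text \<open>The signs give the directions in which \<open>f\<close> increases in each coordinate.
  \<open>C\<close> decides which coordinate wins when the directions conflict, and that coordinate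
  gets the factor \<open>n\<close>. Two signs and one winner account for the eight
  labelings.\<close>

lemma canonical_labeling_of_signs:
  fixes f :: "nat \<Rightarrow> nat \<Rightarrow> nat" and s t :: int
  assumes s: "s = 1 \<or> s = -1" and t: "t = 1 \<or> t = -1"
    and A: "\<And>a b c. {a, b, c} \<subseteq> {1..n} \<Longrightarrow> s * a < s * b \<Longrightarrow> f a c < f b c"
    and B: "\<And>a b c. {a, b, c} \<subseteq> {1..n} \<Longrightarrow> t * a < t * b \<Longrightarrow> f c a < f c b"
    and C: "(\<forall>a b c d. {a, b, c, d} \<subseteq> {1..n} \<and> s * a < s * c \<and> t * d < t * b \<longrightarrow> f a b < f c d) \<or>
      (\<forall>a b c d. {a, b, c, d} \<subseteq> {1..n} \<and> s * a < s * c \<and> t * d < t * b \<longrightarrow> f c d < f a b)"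
  shows "\<exists>L\<in>part_labelings n. \<forall>a\<in>{1..n}. \<forall>b\<in>{1..n}. \<forall>c\<in>{1..n}. \<forall>d\<in>{1..n}.
    f a b \<le> f c d \<longleftrightarrow> L (int a) (int b) \<le> L (int c) (int d)"
proof -
  have close: "\<bar>s * int a - s * int b\<bar> < int n" "\<bar>t * int a - t * int b\<bar> < int n"
    if "a \<in> {1..n}" "b \<in> {1..n}" for a b
    using s t that by auto
  have eq: "s * int a = s * int b \<longleftrightarrow> a = b" "t * int a = t * int b \<longleftrightarrow> a = b" for a b
    using s t by auto
  have both: "f a b < f c d"
    if "{a, b, c, d} \<subseteq> {1..n}" "s * a < s * c" "t * b < t * d" for a b c d
    using A[of a c b] B[of b d c] that by auto
  from C show ?thesis
  proof
    assume C1: "\<forall>a b c d. {a, b, c, d} \<subseteq> {1..n} \<and> s * a < s * c \<and> t * d < t * b \<longrightarrow> f a b < f c d"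
    have less: "f a b < f c d"
      if r: "{a, b, c, d} \<subseteq> {1..n}" and h: "s * a < s * c \<or> a = c \<and> t * b < t * d" for a b c d
    proof -
      from h consider "a = c" "t * b < t * d" | "s * a < s * c" "t * b < t * d"
        | "s * a < s * c" "b = d" | "s * a < s * c" "t * d < t * b"
        using eq(2)[of b d] by linarith
      then show ?thesis
      proof cases
        case 1 then show ?thesis using B[of b d a] r by auto
      next
        case 2 then show ?thesis using both r by blast
      next
        case 3 then show ?thesis using A[of a c b] r by auto
      next
        case 4 then show ?thesis using C1 r by blast
      qed
    qed
    have "f a b \<le> f c d \<longleftrightarrow> int n * (s * int a) + t * int b \<le> int n * (s * int c) + t * int d"
      if r: "{a, b, c, d} \<subseteq> {1..n}" for a b c d
    proof -
      have "int n * (s * int a) + t * int b \<le> int n * (s * int c) + t * int d \<longleftrightarrow>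
          s * int a < s * int c \<or> a = c \<and> t * int b \<le> t * int d"
        using lex_le_iff[OF close(2)[of b d]] r eq(1) by auto
      moreover have "f c d < f a b" if "\<not> (s * int a < s * int c \<or> a = c \<and> t * int b \<le> t * int d)"
        by (rule less) (use that r eq(1)[of a c] in auto)
      moreover have "f a b \<le> f c d" if "s * int a < s * int c \<or> a = c \<and> t * int b \<le> t * int d"
      proof -
        have "(s * int a < s * int c \<or> a = c \<and> t * int b < t * int d) \<or> a = c \<and> b = d"
          using that eq(2)[of b d] by linarith
        then show ?thesis using less[OF r] by auto
      qed
      ultimately show ?thesis by (meson leD)
    qed
    moreover have "(\<lambda>a b. int n * (s * a) + t * b) \<in> part_labelings n"
      using s t by (auto simp: part_labelings_def)
    ultimately show ?thesis by (intro bexI) auto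
  next
    assume C2: "\<forall>a b c d. {a, b, c, d} \<subseteq> {1..n} \<and> s * a < s * c \<and> t * d < t * b \<longrightarrow> f c d < f a b"
    have less: "f a b < f c d"
      if r: "{a, b, c, d} \<subseteq> {1..n}" and h: "t * b < t * d \<or> b = d \<and> s * a < s * c" for a b c d
    proof -
      from h consider "b = d" "s * a < s * c" | "t * b < t * d" "s * a < s * c"
        | "t * b < t * d" "a = c" | "t * b < t * d" "s * c < s * a"
        using eq(1)[of a c] by linarith
      then show ?thesis
      proof cases
        case 1 then show ?thesis using A[of a c b] r by auto
      next
        case 2 then show ?thesis using both r by blast
      next
        case 3 then show ?thesis using B[of b d a] r by auto
      next
        case 4 then show ?thesis using C2[rule_format, of c d a b] r by auto
      qed
    qed
    have "f a b \<le> f c d \<longleftrightarrow> int n * (t * int b) + s * int a \<le> int n * (t * int d) + s * int c"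
      if r: "{a, b, c, d} \<subseteq> {1..n}" for a b c d
    proof -
      have "int n * (t * int b) + s * int a \<le> int n * (t * int d) + s * int c \<longleftrightarrow>
          t * int b < t * int d \<or> b = d \<and> s * int a \<le> s * int c"
        using lex_le_iff[OF close(1)[of a c]] r eq(2) by auto
      moreover have "f c d < f a b" if "\<not> (t * int b < t * int d \<or> b = d \<and> s * int a \<le> s * int c)"
        by (rule less) (use that r eq(2)[of b d] in auto)
      moreover have "f a b \<le> f c d" if "t * int b < t * int d \<or> b = d \<and> s * int a \<le> s * int c"
      proof -
        have "(t * int b < t * int d \<or> b = d \<and> s * int a < s * int c) \<or> a = c \<and> b = d"
          using that eq(1)[of a c] by linarith
        then show ?thesis using less[OF r] by auto
      qed
      ultimately show ?thesis by (meson leD)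
    qed
    moreover have "(\<lambda>a b. int n * (t * b) + s * a) \<in> part_labelings n"
      using s t by (auto simp: part_labelings_def)
    ultimately show ?thesis by (intro bexI) auto
  qed
qed

text \<open>Edges with a common second endpoint determine the sign of the first coordinate, and vice
  versa. For \<open>n = 1\<close> no such comparisons exist and either sign is correct.\<close>

lemma canonical_labeling_of_sign_invariant:
  fixes f :: "nat \<Rightarrow> nat \<Rightarrow> nat"
  assumes inv: "\<And>a b c d a' b' c' d'. {a, b, c, d, a', b', c', d'} \<subseteq> {1..n} \<Longrightarrow>
      a < c \<longleftrightarrow> a' < c' \<Longrightarrow> c < a \<longleftrightarrow> c' < a' \<Longrightarrow> b < d \<longleftrightarrow> b' < d' \<Longrightarrow> d < b \<longleftrightarrow> d' < b' \<Longrightarrow>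
      f a b \<le> f c d \<longleftrightarrow> f a' b' \<le> f c' d'"
    and inj: "\<And>a b c d. {a, b, c, d} \<subseteq> {1..n} \<Longrightarrow> f a b = f c d \<Longrightarrow> a = c \<and> b = d"
  shows "\<exists>L\<in>part_labelings n. \<forall>a\<in>{1..n}. \<forall>b\<in>{1..n}. \<forall>c\<in>{1..n}. \<forall>d\<in>{1..n}.
    f a b \<le> f c d \<longleftrightarrow> L (int a) (int b) \<le> L (int c) (int d)"
proof -
  have "(\<forall>p. (case p of (a, b, c) \<Rightarrow> {a, b, c} \<subseteq> {1..n} \<and> a < b) \<longrightarrow>
        (case p of (a, b, c) \<Rightarrow> f a c) < (case p of (a, b, c) \<Rightarrow> f b c)) \<or>
      (\<forall>p. (case p of (a, b, c) \<Rightarrow> {a, b, c} \<subseteq> {1..n} \<and> a < b) \<longrightarrow>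
        (case p of (a, b, c) \<Rightarrow> f b c) < (case p of (a, b, c) \<Rightarrow> f a c))"
  proof (rule comparison_dichotomy; clarsimp simp only: split_paired_all prod.case)
    show "f a c \<le> f b c \<longleftrightarrow> f a' c' \<le> f b' c'"
      if "{a, b, c} \<subseteq> {1..n}" "a < b" "{a', b', c'} \<subseteq> {1..n}" "a' < b'" for a b c a' b' c'
      by (rule inv) (use that in auto)
    show False if "{a, b, c} \<subseteq> {1..n}" "a < b" "f a c = f b c" for a b c
      using inj[of a c b c] that by auto
  qed
  then have "\<exists>s::int. (s = 1 \<or> s = -1) \<and>
      (\<forall>a b c. {a, b, c} \<subseteq> {1..n} \<longrightarrow> s * a < s * b \<longrightarrow> f a c < f b c)"
  proof
    assume "\<forall>p. (case p of (a, b, c) \<Rightarrow> {a, b, c} \<subseteq> {1..n} \<and> a < b) \<longrightarrow>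
        (case p of (a, b, c) \<Rightarrow> f a c) < (case p of (a, b, c) \<Rightarrow> f b c)"
    then show ?thesis by (intro exI[of _ 1]) auto
  next
    assume "\<forall>p. (case p of (a, b, c) \<Rightarrow> {a, b, c} \<subseteq> {1..n} \<and> a < b) \<longrightarrow>
        (case p of (a, b, c) \<Rightarrow> f b c) < (case p of (a, b, c) \<Rightarrow> f a c)"
    then show ?thesis by (intro exI[of _ "-1"]) auto
  qed
  then obtain s :: int where s: "s = 1 \<or> s = -1"
    "\<And>a b c. {a, b, c} \<subseteq> {1..n} \<Longrightarrow> s * a < s * b \<Longrightarrow> f a c < f b c" by blast
  have "(\<forall>p. (case p of (a, b, c) \<Rightarrow> {a, b, c} \<subseteq> {1..n} \<and> a < b) \<longrightarrow>
        (case p of (a, b, c) \<Rightarrow> f c a) < (case p of (a, b, c) \<Rightarrow> f c b)) \<or>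
      (\<forall>p. (case p of (a, b, c) \<Rightarrow> {a, b, c} \<subseteq> {1..n} \<and> a < b) \<longrightarrow>
        (case p of (a, b, c) \<Rightarrow> f c b) < (case p of (a, b, c) \<Rightarrow> f c a))"
  proof (rule comparison_dichotomy; clarsimp simp only: split_paired_all prod.case)
    show "f c a \<le> f c b \<longleftrightarrow> f c' a' \<le> f c' b'"
      if "{a, b, c} \<subseteq> {1..n}" "a < b" "{a', b', c'} \<subseteq> {1..n}" "a' < b'" for a b c a' b' c'
      by (rule inv) (use that in auto)
    show False if "{a, b, c} \<subseteq> {1..n}" "a < b" "f c a = f c b" for a b c
      using inj[of c a c b] that by auto
  qed
  then have "\<exists>t::int. (t = 1 \<or> t = -1) \<and>
      (\<forall>a b c. {a, b, c} \<subseteq> {1..n} \<longrightarrow> t * a < t * b \<longrightarrow> f c a < f c b)"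
  proof
    assume "\<forall>p. (case p of (a, b, c) \<Rightarrow> {a, b, c} \<subseteq> {1..n} \<and> a < b) \<longrightarrow>
        (case p of (a, b, c) \<Rightarrow> f c a) < (case p of (a, b, c) \<Rightarrow> f c b)"
    then show ?thesis by (intro exI[of _ 1]) auto
  next
    assume "\<forall>p. (case p of (a, b, c) \<Rightarrow> {a, b, c} \<subseteq> {1..n} \<and> a < b) \<longrightarrow>
        (case p of (a, b, c) \<Rightarrow> f c b) < (case p of (a, b, c) \<Rightarrow> f c a)"
    then show ?thesis by (intro exI[of _ "-1"]) auto
  qed
  then obtain t :: int where t: "t = 1 \<or> t = -1"
    "\<And>a b c. {a, b, c} \<subseteq> {1..n} \<Longrightarrow> t * a < t * b \<Longrightarrow> f c a < f c b" by blast
  \<comment> \<open>The conflicting pairs: the first coordinate favours \<open>f a b\<close>, the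
    second favours \<open>f c d\<close>. The condition fixes the signs of both differences, so all
    these pairs have the same outcome.\<close>
  let ?D = "\<lambda>(a, b, c, d). {a, b, c, d} \<subseteq> {1..n} \<and> s * int a < s * int c \<and> t * int d < t * int b"
  have "(\<forall>p. ?D p \<longrightarrow> (case p of (a, b, c, d) \<Rightarrow> f a b) < (case p of (a, b, c, d) \<Rightarrow> f c d)) \<or>
      (\<forall>p. ?D p \<longrightarrow> (case p of (a, b, c, d) \<Rightarrow> f c d) < (case p of (a, b, c, d) \<Rightarrow> f a b))"
  proof (rule comparison_dichotomy; clarsimp simp only: split_paired_all prod.case)
    show "f a b \<le> f c d \<longleftrightarrow> f a' b' \<le> f c' d'"
      if "{a, b, c, d} \<subseteq> {1..n}" "s * int a < s * int c" "t * int d < t * int b"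
        "{a', b', c', d'} \<subseteq> {1..n}" "s * int a' < s * int c'" "t * int d' < t * int b'"
      for a b c d a' b' c' d'
      by (rule inv) (use that s(1) t(1) in auto)
    show False
      if "{a, b, c, d} \<subseteq> {1..n}" "s * int a < s * int c" "f a b = f c d" for a b c d
      using inj[of a b c d] that by auto
  qed
  then have "(\<forall>a b c d. {a, b, c, d} \<subseteq> {1..n} \<and> s * int a < s * int c \<and> t * int d < t * int b \<longrightarrow>
        f a b < f c d) \<or>
      (\<forall>a b c d. {a, b, c, d} \<subseteq> {1..n} \<and> s * int a < s * int c \<and> t * int d < t * int b \<longrightarrow>
        f c d < f a b)"
    by (simp only: split_paired_All prod.case)
  from canonical_labeling_of_signs[OF s(1) t(1) s(2) t(2) this] show ?thesis by blast
qed

text \<open>Here \<open>a\<close> and \<open>c\<close> are positions in the shared class. The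
  outcome is constant on each of a < c, a = c and a > c, which leaves eight combinations: two are
  precedence, four are the interleavings, and two contradict transitivity.\<close>

lemma interleaved_of_sign_invariant:
  fixes f g :: "nat \<Rightarrow> nat \<Rightarrow> nat"
  assumes inv: "\<And>a b c d a' b' c' d'. {a, b, c, d, a', b', c', d'} \<subseteq> {1..n} \<Longrightarrow>
      a < c \<longleftrightarrow> a' < c' \<Longrightarrow> c < a \<longleftrightarrow> c' < a' \<Longrightarrow> f a b \<le> g c d \<longleftrightarrow> f a' b' \<le> g c' d'"
    and neq: "\<And>a b c d. {a, b, c, d} \<subseteq> {1..n} \<Longrightarrow> f a b \<noteq> g c d"
  shows "(\<forall>a b c d. {a, b, c, d} \<subseteq> {1..n} \<longrightarrow> f a b < g c d) \<or>
    (\<forall>a b c d. {a, b, c, d} \<subseteq> {1..n} \<longrightarrow> g c d < f a b) \<or>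
    (\<exists>cmp \<in> {(<), (\<le>), (>), (\<ge>)} :: (nat \<Rightarrow> nat \<Rightarrow> bool) set.
       \<forall>a b c d. {a, b, c, d} \<subseteq> {1..n} \<longrightarrow> f a b < g c d \<longleftrightarrow> cmp a c)"
proof -
  have dich: "(\<forall>a b c d. {a, b, c, d} \<subseteq> {1..n} \<and> Q a c \<longrightarrow> f a b < g c d) \<or>
      (\<forall>a b c d. {a, b, c, d} \<subseteq> {1..n} \<and> Q a c \<longrightarrow> g c d < f a b)"
    if Q: "\<And>a c a' c'. Q a c \<Longrightarrow> Q a' c' \<Longrightarrow> (a < c \<longleftrightarrow> a' < c') \<and> (c < a \<longleftrightarrow> c' < a')" for Q
  proof -
    let ?D = "\<lambda>(a, b, c, d). {a, b, c, d} \<subseteq> {1..n} \<and> Q a c"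
    have "(\<forall>p. ?D p \<longrightarrow> (case p of (a, b, c, d) \<Rightarrow> f a b) < (case p of (a, b, c, d) \<Rightarrow> g c d)) \<or>
        (\<forall>p. ?D p \<longrightarrow> (case p of (a, b, c, d) \<Rightarrow> g c d) < (case p of (a, b, c, d) \<Rightarrow> f a b))"
    proof (rule comparison_dichotomy; clarsimp simp only: split_paired_all prod.case)
      show "f a b \<le> g c d \<longleftrightarrow> f a' b' \<le> g c' d'"
        if "{a, b, c, d} \<subseteq> {1..n}" "Q a c" "{a', b', c', d'} \<subseteq> {1..n}" "Q a' c'"
        for a b c d a' b' c' d'
        by (rule inv) (use that Q[of a c a' c'] in auto)
      show False if "{a, b, c, d} \<subseteq> {1..n}" "f a b = g c d" for a b c d
        using neq[of a b c d] that by auto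
    qed
    then show ?thesis by (simp only: split_paired_All prod.case)
  qed
  have lt: "(\<forall>a b c d. {a, b, c, d} \<subseteq> {1..n} \<and> a < c \<longrightarrow> f a b < g c d) \<or>
      (\<forall>a b c d. {a, b, c, d} \<subseteq> {1..n} \<and> a < c \<longrightarrow> g c d < f a b)" (is "?LL \<or> ?LG")
    by (rule dich) auto
  have gt: "(\<forall>a b c d. {a, b, c, d} \<subseteq> {1..n} \<and> c < a \<longrightarrow> f a b < g c d) \<or>
      (\<forall>a b c d. {a, b, c, d} \<subseteq> {1..n} \<and> c < a \<longrightarrow> g c d < f a b)" (is "?GL \<or> ?GG")
    by (rule dich) auto
  have eq: "(\<forall>a b c d. {a, b, c, d} \<subseteq> {1..n} \<and> a = c \<longrightarrow> f a b < g c d) \<or>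
      (\<forall>a b c d. {a, b, c, d} \<subseteq> {1..n} \<and> a = c \<longrightarrow> g c d < f a b)" (is "?EL \<or> ?EG")
    by (rule dich) auto
  have all_less: ?thesis if "?LL" "?EL" "?GL"
  proof (rule disjI1, intro allI impI)
    fix a b c d assume "{a, b, c, d} \<subseteq> {1..n}"
    then show "f a b < g c d" using that[rule_format, of a b c d] linorder_less_linear[of a c] by blast
  qed
  have all_greater: ?thesis if "?LG" "?EG" "?GG"
  proof (rule disjI2, rule disjI1, intro allI impI)
    fix a b c d assume "{a, b, c, d} \<subseteq> {1..n}"
    then show "g c d < f a b" using that[rule_format, of a b c d] linorder_less_linear[of a c] by blast
  qed
  have cmpI: ?thesis
    if "cmp \<in> {(<), (\<le>), (>), (\<ge>)}"
      "\<And>a b c d. {a, b, c, d} \<subseteq> {1..n} \<Longrightarrow> f a b < g c d \<longleftrightarrow> cmp a c" for cmp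
    by (intro disjI2 bexI[OF _ that(1)] allI impI) (rule that(2))
  show ?thesis
  proof (cases "n \<ge> 2")
    case False
    \<comment> \<open>With at most one position only a = c can occur, so its outcome alone decides.
      The contradictions below need two different positions.\<close>
    then have "a = c" if "{a, b, c, d} \<subseteq> {1..n}" for a b c d :: nat using that by auto
    then have "?LL" "?GL" "?LG" "?GG" by blast+
    from eq show ?thesis
    proof
      assume "?EL" show ?thesis by (rule all_less) fact+
    next
      assume "?EG" show ?thesis by (rule all_greater) fact+
    qed
  next
    case True
    then have r: "{1, 2} \<subseteq> {1..n}" by auto
    from lt eq gt show ?thesis
    proof (elim disjE)
      assume "?LL" "?EL" "?GL" then show ?thesis by (rule all_less)
    next
      assume *: "?LL" "?EL" "?GG"
      show ?thesis
      proof (rule cmpI[of "(\<le>)"])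
        fix a b c d assume "{a, b, c, d} \<subseteq> {1..n}"
        then show "f a b < g c d \<longleftrightarrow> a \<le> c"
          using *[rule_format, of a b c d] by (cases a c rule: linorder_cases) auto
      qed simp
    next
      assume *: "?LL" "?EG" "?GL"
      \<comment> \<open>A cycle through two positions: unequal positions put \<open>f\<close> first
        and equal ones put \<open>g\<close> first. The other impossible combination gives the same
        kind of cycle with the roles exchanged.\<close>
      have "f 1 1 < g 2 1" "g 2 1 < f 2 1" "f 2 1 < g 1 1" "g 1 1 < f 1 1" using * r by auto
      then show ?thesis by linarith
    next
      assume *: "?LL" "?EG" "?GG"
      show ?thesis
      proof (rule cmpI[of "(<)"])
        fix a b c d assume "{a, b, c, d} \<subseteq> {1..n}"
        then show "f a b < g c d \<longleftrightarrow> a < c"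
          using *[rule_format, of a b c d] by (cases a c rule: linorder_cases) auto
      qed simp
    next
      assume *: "?LG" "?EL" "?GL"
      show ?thesis
      proof (rule cmpI[of "(\<ge>)"])
        fix a b c d assume "{a, b, c, d} \<subseteq> {1..n}"
        then show "f a b < g c d \<longleftrightarrow> c \<le> a"
          using *[rule_format, of a b c d] by (cases a c rule: linorder_cases) auto
      qed simp
    next
      assume *: "?LG" "?EL" "?GG"
      have "g 2 1 < f 1 1" "f 2 1 < g 2 1" "g 1 1 < f 2 1" "f 1 1 < g 1 1" using * r by auto
      then show ?thesis by linarith
    next
      assume *: "?LG" "?EG" "?GL"
      show ?thesis
      proof (rule cmpI[of "(>)"])
        fix a b c d assume "{a, b, c, d} \<subseteq> {1..n}"
        then show "f a b < g c d \<longleftrightarrow> c < a"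
          using *[rule_format, of a b c d] by (cases a c rule: linorder_cases) auto
      qed simp
    next
      assume "?LG" "?EG" "?GG" then show ?thesis by (rule all_greater)
    qed
  qed
qed

section \<open>Canonical orders inside large complete multipartite graphs\<close>

lemma multipartite_edge_iff:
  "{(i, a), (j, b)} \<in> edges (complete_multipartite k n) \<longleftrightarrow>
     i \<in> {1..k} \<and> j \<in> {1..k} \<and> a \<in> {1..n} \<and> b \<in> {1..n} \<and> i \<noteq> j"
  by (auto simp: complete_multipartite_def doubleton_eq_iff)

lemma multipartite_edgeE:
  assumes "e \<in> edges (complete_multipartite k n)"
  obtains i a j b where "e = {(i, a), (j, b)}" "i \<in> {1..k}" "j \<in> {1..k}" "a \<in> {1..n}" "b \<in> {1..n}"
    "i \<noteq> j"
  using assms by (auto simp: complete_multipartite_def)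

lemma simple_graph_complete_multipartite: "simple_graph (complete_multipartite k n)"
  by (auto simp: simple_graph_def complete_multipartite_def)

lemma finite_edges: "simple_graph G \<Longrightarrow> finite (edges G)"
  unfolding simple_graph_def by (meson finite_imp_finite_nsets finite_subset)

lemma part_cong: "{a, b} = {c, d} \<Longrightarrow> part n a b = part n c d"
  unfolding part_def doubleton_eq_iff by (auto simp: insert_commute)

text \<open>Block \<open>i\<close> ends at \<open>i * n\<close>, which lies before the first
  position of every later block.\<close>

lemma block_position_less_iff:
  fixes i j a b n :: nat
  assumes "1 \<le> i" "1 \<le> j" "a \<in> {1..n}" "b \<in> {1..n}"
  shows "(i - 1) * n + a < (j - 1) * n + b \<longleftrightarrow> i < j \<or> i = j \<and> a < b"
proof -
  have step: "(i - 1) * n + a < (j - 1) * n + b"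
    if "1 \<le> i" "i < j" "a \<le> n" "1 \<le> b" for i j a b :: nat
  proof -
    have "(i - 1) * n + n = (i - 1 + 1) * n" by (simp only: distrib_right mult_1)
    also have "\<dots> \<le> (j - 1) * n" by (rule mult_le_mono1) (use that in linarith)
    finally show ?thesis using that by linarith
  qed
  show ?thesis
  proof (cases i j rule: linorder_cases)
    case less then show ?thesis using step[of i j a b] assms by auto
  next
    case greater then show ?thesis using step[of j i b a] assms by auto
  qed auto
qed

text \<open>
  All classes are cut out of one order-homogeneous set, the \<open>i\<close>-th class using its \<open>i\<close>-th block of
  length \<open>n\<close>. The order type of a tuple then only depends on the comparisons within the classes.
\<close>

lemma ramsey_complete_multipartite:
  fixes k n :: nat
  obtains N :: nat where "\<And>R. edge_ordering (complete_multipartite k N) R \<Longrightarrow>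
    \<exists>R' f. canonical_edge_ordering k n R' \<and>
      embeds f (with_order (complete_multipartite k n) R') (with_order (complete_multipartite k N) R)"
proof -
  \<comment> \<open>A tag lists the classes of the four endpoints, and the tuple lists their
    positions inside the classes. All combinations of classes are made homogeneous at once.\<close>
  define T where "T = {t :: nat list. set t \<subseteq> {1..k} \<and> length t = 4}"
  have "finite T" unfolding T_def by (rule finite_lists_length_eq) simp
  then obtain N :: nat where N: "\<And>P :: nat list \<Rightarrow> nat list \<Rightarrow> bool.
     \<exists>z. strict_mono_on {1..k * n} z \<and> z ` {1..k * n} \<subseteq> {1..N} \<and>
      (\<forall>t\<in>T. \<forall>x y. length x = 4 \<longrightarrow> set x \<union> set y \<subseteq> {1..k * n} \<longrightarrow> same_order_type x y \<longrightarrow>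
         P t (map z x) = P t (map z y))"
    using ramsey_order_type[of T] by metis
  show thesis
  proof (rule that[of N])
    fix R assume R: "edge_ordering (complete_multipartite k N) R"
    let ?E = "edges (complete_multipartite k n)" and ?EN = "edges (complete_multipartite k N)"
    have fin: "finite ?EN"
      by (rule finite_edges[OF simple_graph_complete_multipartite])
    obtain l :: "(nat \<times> nat) set \<Rightarrow> nat" where l: "inj_on l ?EN"
      "\<And>d e. d \<in> ?EN \<Longrightarrow> e \<in> ?EN \<Longrightarrow> (d, e) \<in> R \<longleftrightarrow> l d \<le> l e"
      using edge_labelingE[OF fin R[unfolded edge_ordering_def]] by metis
    define P where "P t x \<longleftrightarrow>
      l {(t ! 0, x ! 0), (t ! 1, x ! 1)} \<le> l {(t ! 2, x ! 2), (t ! 3, x ! 3)}" for t x :: "nat list"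
    obtain z where z: "strict_mono_on {1..k * n} z" "z ` {1..k * n} \<subseteq> {1..N}"
      and hom: "\<And>t x y. t \<in> T \<Longrightarrow> length x = 4 \<Longrightarrow> set x \<union> set y \<subseteq> {1..k * n} \<Longrightarrow>
        same_order_type x y \<Longrightarrow> P t (map z x) = P t (map z y)"
    proof -
      obtain z where "strict_mono_on {1..k * n} z \<and> z ` {1..k * n} \<subseteq> {1..N} \<and>
        (\<forall>t\<in>T. \<forall>x y. length x = 4 \<longrightarrow> set x \<union> set y \<subseteq> {1..k * n} \<longrightarrow> same_order_type x y \<longrightarrow>
          P t (map z x) = P t (map z y))"
        using N[of P] by (elim exE)
      then show thesis by (intro that[of z]) auto
    qed
    define pos where "pos i a = (i - 1) * n + a" for i a
    have pos_range: "pos i a \<in> {1..k * n}" if "i \<in> {1..k}" "a \<in> {1..n}" for i a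
    proof -
      have "(i - 1 + 1) * n \<le> k * n" by (rule mult_le_mono1) (use that in auto)
      then show ?thesis using that by (simp add: pos_def distrib_right)
    qed
    have pos_less: "pos i a < pos j b \<longleftrightarrow> i < j \<or> i = j \<and> a < b"
      if "i \<in> {1..k}" "j \<in> {1..k}" "a \<in> {1..n}" "b \<in> {1..n}" for i j a b
      unfolding pos_def by (rule block_position_less_iff) (use that in auto)
    have pos_eq: "pos i a = pos i b \<longleftrightarrow> a = b" for i a b
      by (simp add: pos_def)
    \<comment> \<open>The class index is kept and only the position inside the class moves, so
      \<open>f\<close> respects the partition.\<close>
    define f where "f = (\<lambda>(i, a). (i, z (pos i a)))"
    define F where "F i a j b = l {f (i, a), f (j, b)}" for i a j b
    have f_inj: "inj_on f (verts (complete_multipartite k n))"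
    proof (rule inj_onI, clarsimp simp: complete_multipartite_def f_def simp del: One_nat_def)
      fix i a b assume ia: "1 \<le> i" "i \<le> k" "1 \<le> a" "a \<le> n" "1 \<le> b" "b \<le> n"
        and eq: "z (pos i a) = z (pos i b)"
      have "pos i a = pos i b"
        by (rule inj_onD[OF strict_mono_on_imp_inj_on[OF z(1)] eq]) (use ia pos_range in auto)
      then show "a = b" by (simp add: pos_eq)
    qed
    have f_verts: "f ` verts (complete_multipartite k n) \<subseteq> verts (complete_multipartite k N)"
    proof -
      have "z (pos i a) \<in> {1..N}" if "i \<in> {1..k}" "a \<in> {1..n}" for i a
        using z(2) pos_range[OF that] by blast
      then show ?thesis by (auto simp: f_def complete_multipartite_def)
    qed
    have f_edge: "f ` e \<in> ?EN" if "e \<in> ?E" for e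
    proof -
      from that obtain i a j b where e: "e = {(i, a), (j, b)}" "i \<in> {1..k}" "j \<in> {1..k}"
        "a \<in> {1..n}" "b \<in> {1..n}" "i \<noteq> j"
        by (rule multipartite_edgeE)
      have "z (pos i a) \<in> {1..N}" "z (pos j b) \<in> {1..N}" using z(2) pos_range e by blast+
      then show ?thesis using e by (simp add: f_def multipartite_edge_iff)
    qed
    have F_inv: "F i1 a i2 b \<le> F i3 c i4 d \<longleftrightarrow> F i1 a' i2 b' \<le> F i3 c' i4 d'"
      if i: "{i1, i2, i3, i4} \<subseteq> {1..k}" and a: "{a, b, c, d, a', b', c', d'} \<subseteq> {1..n}"
        and so: "same_order_type [pos i1 a, pos i2 b, pos i3 c, pos i4 d]
          [pos i1 a', pos i2 b', pos i3 c', pos i4 d']"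
      for i1 i2 i3 i4 a b c d a' b' c' d'
    proof -
      have "[i1, i2, i3, i4] \<in> T" using i by (auto simp: T_def)
      moreover have "set [pos i1 a, pos i2 b, pos i3 c, pos i4 d] \<union>
          set [pos i1 a', pos i2 b', pos i3 c', pos i4 d'] \<subseteq> {1..k * n}"
        using i a pos_range by auto
      ultimately show ?thesis
        using hom[OF _ _ _ so, of "[i1, i2, i3, i4]"]
        by (simp add: P_def F_def f_def numeral_eq_Suc)
    qed
    have F_inj: "{(i1, a), (i2, b)} = {(i3, c), (i4, d)}"
      if i: "{i1, i2, i3, i4} \<subseteq> {1..k}" and a: "{a, b, c, d} \<subseteq> {1..n}" and "i1 \<noteq> i2" "i3 \<noteq> i4"
        and eq: "F i1 a i2 b = F i3 c i4 d"
      for i1 i2 i3 i4 a b c d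
    proof -
      have E: "{(i1, a), (i2, b)} \<in> ?E" "{(i3, c), (i4, d)} \<in> ?E"
        using that by (auto simp: multipartite_edge_iff)
      have "f ` {(i1, a), (i2, b)} = f ` {(i3, c), (i4, d)}"
        by (rule inj_onD[OF l(1)]) (use eq f_edge[OF E(1)] f_edge[OF E(2)] in \<open>auto simp: F_def\<close>)
      then show ?thesis
        using inj_on_image_edges[OF simple_graph_complete_multipartite f_inj] E by (meson inj_onD)
    qed
    \<comment> \<open>The given order pulled back along \<open>f\<close>; everything below shows
      that it is canonical.\<close>
    define R' where "R' = {(d, e). d \<in> ?E \<and> e \<in> ?E \<and> l (f ` d) \<le> l (f ` e)}"
    have inj_lf: "inj_on (\<lambda>e. l (f ` e)) ?E"
      using inj_on_image_edges[OF simple_graph_complete_multipartite f_inj] l(1) f_edge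
      by (auto simp: inj_on_def)
    have R'_iff: "({(i1, a), (i2, b)}, {(i3, c), (i4, d)}) \<in> R' \<longleftrightarrow> F i1 a i2 b \<le> F i3 c i4 d"
      if "{i1, i2, i3, i4} \<subseteq> {1..k}" "{a, b, c, d} \<subseteq> {1..n}" "i1 \<noteq> i2" "i3 \<noteq> i4"
      for i1 i2 i3 i4 a b c d
      using that by (auto simp: R'_def F_def multipartite_edge_iff)
    have R'_less: "precedes R' {(i1, a), (i2, b)} {(i3, c), (i4, d)} \<longleftrightarrow> F i1 a i2 b < F i3 c i4 d"
      if r: "{i1, i2, i3, i4} \<subseteq> {1..k}" "{a, b, c, d} \<subseteq> {1..n}" "i1 \<noteq> i2" "i3 \<noteq> i4"
      for i1 i2 i3 i4 a b c d
    proof -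
      have "F i1 a i2 b = F i3 c i4 d \<longleftrightarrow> {(i1, a), (i2, b)} = {(i3, c), (i4, d)}"
        by (subst inj_on_eq_iff[OF inj_lf, symmetric])
          (use r in \<open>auto simp: F_def multipartite_edge_iff\<close>)
      then show ?thesis
        unfolding precedes_def R'_iff[OF r] by (simp only: less_le)
    qed
    have "canonical_edge_ordering k n R'"
      unfolding canonical_edge_ordering_def
    proof (intro conjI ballI impI)
      show "edge_ordering (complete_multipartite k n) R'"
        unfolding edge_ordering_def R'_def by (rule linear_order_on_labels[OF inj_lf])
    next
      fix i1 i2 assume i: "i1 \<in> {1..k}" "i2 \<in> {1..k}" "i1 \<noteq> i2"
      have "\<exists>L\<in>part_labelings n. \<forall>a\<in>{1..n}. \<forall>b\<in>{1..n}. \<forall>c\<in>{1..n}. \<forall>d\<in>{1..n}.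
        F i1 a i2 b \<le> F i1 c i2 d \<longleftrightarrow> L (int a) (int b) \<le> L (int c) (int d)"
      proof (rule canonical_labeling_of_sign_invariant)
        show "F i1 a i2 b \<le> F i1 c i2 d \<longleftrightarrow> F i1 a' i2 b' \<le> F i1 c' i2 d'"
          if "{a, b, c, d, a', b', c', d'} \<subseteq> {1..n}" "a < c \<longleftrightarrow> a' < c'" "c < a \<longleftrightarrow> c' < a'"
            "b < d \<longleftrightarrow> b' < d'" "d < b \<longleftrightarrow> d' < b'" for a b c d a' b' c' d'
          by (rule F_inv) (use that i in \<open>auto simp: same_order_type_four pos_less simp del: One_nat_def\<close>)
        show "a = c \<and> b = d" if "{a, b, c, d} \<subseteq> {1..n}" "F i1 a i2 b = F i1 c i2 d" for a b c d
          using F_inj[of i1 i2 i1 i2 a b c d] that i by (auto simp: doubleton_eq_iff)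
      qed
      then obtain L where "L \<in> part_labelings n" "\<forall>a\<in>{1..n}. \<forall>b\<in>{1..n}. \<forall>c\<in>{1..n}. \<forall>d\<in>{1..n}.
        F i1 a i2 b \<le> F i1 c i2 d \<longleftrightarrow> L (int a) (int b) \<le> L (int c) (int d)" ..
      then show "canonical_on_part n R' i1 i2"
        unfolding canonical_on_part_def using R'_iff[of i1 i2 i1 i2] i
        by (intro bexI[of _ L]) (simp_all del: One_nat_def)
    next
      fix i1 i2 i3 i4 assume i: "i1 \<in> {1..k}" "i2 \<in> {1..k}" "i3 \<in> {1..k}" "i4 \<in> {1..k}"
        and ne: "i1 \<noteq> i2 \<and> i3 \<noteq> i4 \<and> {i1, i2} \<noteq> {i3, i4}"
      have precedesI: "part_precedes R' (part n j1 j2) (part n j3 j4)"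
        if "{j1, j2, j3, j4} \<subseteq> {1..k}" "j1 \<noteq> j2" "j3 \<noteq> j4"
          "\<And>a b c d. {a, b, c, d} \<subseteq> {1..n} \<Longrightarrow> F j1 a j2 b < F j3 c j4 d" for j1 j2 j3 j4
        using that R'_less[of j1 j2 j3 j4] unfolding part_precedes_def part_def by auto
      show "part_precedes R' (part n i1 i2) (part n i3 i4) \<or>
        part_precedes R' (part n i3 i4) (part n i1 i2) \<or>
        (\<exists>a b c. {a, b} = {i1, i2} \<and> {a, c} = {i3, i4} \<and> interleaves n R' a b c)"
      proof (cases "{i1, i2} \<inter> {i3, i4} = {}")
        case True
        \<comment> \<open>Four different classes: the order type of the positions is determined by
          the classes, so every comparison between the two parts has the same outcome.\<close>
        let ?D = "\<lambda>(a, b, c, d). {a, b, c, d} \<subseteq> {1..n}"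
        have "(\<forall>p. ?D p \<longrightarrow> (case p of (a, b, c, d) \<Rightarrow> F i1 a i2 b) < (case p of (a, b, c, d) \<Rightarrow> F i3 c i4 d)) \<or>
          (\<forall>p. ?D p \<longrightarrow> (case p of (a, b, c, d) \<Rightarrow> F i3 c i4 d) < (case p of (a, b, c, d) \<Rightarrow> F i1 a i2 b))"
        proof (rule comparison_dichotomy; clarsimp simp only: split_paired_all prod.case)
          show "F i1 a i2 b \<le> F i3 c i4 d \<longleftrightarrow> F i1 a' i2 b' \<le> F i3 c' i4 d'"
            if "{a, b, c, d} \<subseteq> {1..n}" "{a', b', c', d'} \<subseteq> {1..n}" for a b c d a' b' c' d'
            by (rule F_inv)
              (use that i ne True in \<open>auto simp: same_order_type_four pos_less simp del: One_nat_def\<close>)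
          show False if "{a, b, c, d} \<subseteq> {1..n}" "F i1 a i2 b = F i3 c i4 d" for a b c d
            using F_inj[of i1 i2 i3 i4 a b c d] that i ne True by (auto simp: doubleton_eq_iff)
        qed
        then have "(\<forall>a b c d. {a, b, c, d} \<subseteq> {1..n} \<longrightarrow> F i1 a i2 b < F i3 c i4 d) \<or>
          (\<forall>a b c d. {a, b, c, d} \<subseteq> {1..n} \<longrightarrow> F i3 c i4 d < F i1 a i2 b)"
          by (simp only: split_paired_All prod.case)
        then show ?thesis
        proof
          assume "\<forall>a b c d. {a, b, c, d} \<subseteq> {1..n} \<longrightarrow> F i1 a i2 b < F i3 c i4 d"
          then have "part_precedes R' (part n i1 i2) (part n i3 i4)"
            by (intro precedesI) (use i ne in auto)
          then show ?thesis ..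
        next
          assume "\<forall>a b c d. {a, b, c, d} \<subseteq> {1..n} \<longrightarrow> F i3 c i4 d < F i1 a i2 b"
          then have "part_precedes R' (part n i3 i4) (part n i1 i2)"
            by (intro precedesI) (use i ne in auto)
          then show ?thesis by simp
        qed
      next
        case False
        \<comment> \<open>Two different pairs of classes that meet share exactly one class, named
          \<open>u\<close>.\<close>
        then obtain u v w where u: "{u, v} = {i1, i2}" "{u, w} = {i3, i4}"
          by (auto simp: doubleton_eq_iff)
        then have v: "u \<noteq> v" "u \<noteq> w" "v \<noteq> w" "{u, v, w} \<subseteq> {1..k}"
          using ne i by (auto simp: doubleton_eq_iff)
        have parts: "part n i1 i2 = part n u v" "part n i3 i4 = part n u w"
          using u part_cong by metis+
        have "(\<forall>a b c d. {a, b, c, d} \<subseteq> {1..n} \<longrightarrow> F u a v b < F u c w d) \<or>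
          (\<forall>a b c d. {a, b, c, d} \<subseteq> {1..n} \<longrightarrow> F u c w d < F u a v b) \<or>
          (\<exists>cmp \<in> {(<), (\<le>), (>), (\<ge>)} :: (nat \<Rightarrow> nat \<Rightarrow> bool) set.
             \<forall>a b c d. {a, b, c, d} \<subseteq> {1..n} \<longrightarrow> F u a v b < F u c w d \<longleftrightarrow> cmp a c)"
        proof (rule interleaved_of_sign_invariant)
          show "F u a v b \<le> F u c w d \<longleftrightarrow> F u a' v b' \<le> F u c' w d'"
            if "{a, b, c, d, a', b', c', d'} \<subseteq> {1..n}" "a < c \<longleftrightarrow> a' < c'" "c < a \<longleftrightarrow> c' < a'"
            for a b c d a' b' c' d'
            by (rule F_inv)
              (use that v in \<open>auto simp: same_order_type_four pos_less simp del: One_nat_def\<close>)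
          show "F u a v b \<noteq> F u c w d" if "{a, b, c, d} \<subseteq> {1..n}" for a b c d
            using F_inj[of u v u w a b c d] that v by (auto simp: doubleton_eq_iff)
        qed
        then show ?thesis
        proof (elim disjE)
          assume "\<forall>a b c d. {a, b, c, d} \<subseteq> {1..n} \<longrightarrow> F u a v b < F u c w d"
          then have "part_precedes R' (part n u v) (part n u w)"
            by (intro precedesI) (use v in auto)
          then show ?thesis unfolding parts ..
        next
          assume "\<forall>a b c d. {a, b, c, d} \<subseteq> {1..n} \<longrightarrow> F u c w d < F u a v b"
          then have "part_precedes R' (part n u w) (part n u v)"
            by (intro precedesI) (use v in auto)
          then show ?thesis unfolding parts by simp
        next
          assume "\<exists>cmp \<in> {(<), (\<le>), (>), (\<ge>)} :: (nat \<Rightarrow> nat \<Rightarrow> bool) set.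
             \<forall>a b c d. {a, b, c, d} \<subseteq> {1..n} \<longrightarrow> F u a v b < F u c w d \<longleftrightarrow> cmp a c"
          then obtain cmp :: "nat \<Rightarrow> nat \<Rightarrow> bool" where cmp: "cmp \<in> {(<), (\<le>), (>), (\<ge>)}"
             "\<forall>a b c d. {a, b, c, d} \<subseteq> {1..n} \<longrightarrow> F u a v b < F u c w d \<longleftrightarrow> cmp a c" ..
          have "interleaves n R' u v w"
            unfolding interleaves_def
          proof (rule bexI[OF _ cmp(1)], intro ballI)
            fix a b c d assume "a \<in> {1..n}" "b \<in> {1..n}" "c \<in> {1..n}" "d \<in> {1..n}"
            then have r: "{a, b, c, d} \<subseteq> {1..n}" by simp
            show "precedes R' {(u, a), (v, b)} {(u, c), (w, d)} \<longleftrightarrow> cmp a c"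
              using R'_less[of u v u w a b c d] v r cmp(2)[rule_format, OF r] by simp
          qed
          then show ?thesis using u by blast
        qed
      qed
    qed
    moreover have "embeds f (with_order (complete_multipartite k n) R')
        (with_order (complete_multipartite k N) R)"
      using f_inj f_verts f_edge l(2) by (auto simp: embeds_def with_order_def R'_def)
    ultimately show "\<exists>R' f. canonical_edge_ordering k n R' \<and>
      embeds f (with_order (complete_multipartite k n) R') (with_order (complete_multipartite k N) R)"
      by blast
  qed
qed

section \<open>Order chromatic number and canonical orders\<close>

text \<open>The value is infinite exactly when every finite graph can avoid the family. Complete
  graphs are decisive, because every finite graph is a subgraph of one and inherits its
  order.\<close>

lemma infinite_order_chromatic_number_iff:
  assumes simple: "\<forall>H\<in>\<H>. simple_graph H"
  shows "order_chromatic_number \<H> = \<infinity> \<longleftrightarrow>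
    (\<exists>L\<in>canonical_labelings. \<forall>n\<ge>1. avoids (labeled_complete_graph L n) \<H>)"
proof
  assume inf: "order_chromatic_number \<H> = \<infinity>"
  show "\<exists>L\<in>canonical_labelings. \<forall>n\<ge>1. avoids (labeled_complete_graph L n) \<H>"
  proof (rule ccontr)
    assume "\<not> (\<exists>L\<in>canonical_labelings. \<forall>n\<ge>1. avoids (labeled_complete_graph L n) \<H>)"
    then have "\<forall>L\<in>canonical_labelings. \<exists>n. \<not> avoids (labeled_complete_graph L n) \<H>" by blast
    then obtain m where m: "\<forall>L\<in>canonical_labelings. \<not> avoids (labeled_complete_graph L (m L)) \<H>"
      by (rule bchoice[THEN exE])
    \<comment> \<open>A size at which all four labelings fail simultaneously, by nesting.\<close>
    define n where "n = Max (m ` canonical_labelings)"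
    have m_le: "m L \<le> n" if "L \<in> canonical_labelings" for L
      unfolding n_def by (rule Max_ge) (use that in \<open>auto simp: canonical_labelings_def\<close>)
    obtain N where N: "\<And>R. edge_ordering (complete_graph N) R \<Longrightarrow> \<exists>L\<in>canonical_labelings. \<exists>f.
        embeds f (labeled_complete_graph L n) (with_order (complete_graph N) R)"
      using ramsey_complete_graph by blast
    have "\<not> can_avoid (complete_graph N) \<H>"
    proof
      assume "can_avoid (complete_graph N) \<H>"
      then obtain R where R: "edge_ordering (complete_graph N) R"
        "avoids (with_order (complete_graph N) R) \<H>"
        unfolding can_avoid_def by blast
      from N[OF R(1)] obtain L f where L: "L \<in> canonical_labelings"
        and f: "embeds f (labeled_complete_graph L n) (with_order (complete_graph N) R)"
        by blast
      have "avoids (labeled_complete_graph L n) \<H>" by (rule avoids_embeds[OF f R(2) simple])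
      then have "avoids (labeled_complete_graph L (m L)) \<H>"
        by (rule avoids_embeds[OF embeds_labeled_complete_graph_mono[OF L m_le[OF L]] _ simple])
      then show False using m L by blast
    qed
    from order_chromatic_number_le[OF simple_graph_complete_graph this] inf show False by simp
  qed
next
  assume "\<exists>L\<in>canonical_labelings. \<forall>n\<ge>1. avoids (labeled_complete_graph L n) \<H>"
  then obtain L where L: "L \<in> canonical_labelings"
    and av: "\<And>n. n \<ge> 1 \<Longrightarrow> avoids (labeled_complete_graph L n) \<H>" by blast
  show "order_chromatic_number \<H> = \<infinity>"
  proof (rule ccontr)
    assume "order_chromatic_number \<H> \<noteq> \<infinity>"
    then obtain G :: "nat sgraph" where G: "simple_graph G" "\<not> can_avoid G \<H>"
      by (rule order_chromatic_number_attained)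
    \<comment> \<open>One more than the number of vertices, so that \<open>n\<close> is at least 1
      even for the empty graph.\<close>
    define n where "n = Suc (card (verts G))"
    obtain c :: "nat \<Rightarrow> nat" where c: "bij_betw c (verts G) {0..<card (verts G)}"
      using ex_bij_betw_finite_nat G(1) unfolding simple_graph_def by blast
    have inj: "inj_on (\<lambda>v. Suc (c v)) (verts G)"
      using c by (auto simp: bij_betw_def inj_on_def)
    have range: "Suc (c v) \<in> {1..n}" if "v \<in> verts G" for v
      using bij_betwE[OF c] that by (auto simp: n_def)
    have edge: "(\<lambda>v. Suc (c v)) ` e \<in> edges (labeled_complete_graph L n)" if "e \<in> edges G" for e
    proof -
      from G(1) that obtain u v where e: "e = {u, v}" "u \<in> verts G" "v \<in> verts G" "u \<noteq> v"
        by (rule simple_graph_edgeE)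
      then have "Suc (c u) \<noteq> Suc (c v)" using inj by (meson inj_onD)
      then show ?thesis using e range[of u] range[of v] by (simp add: complete_graph_def)
    qed
    have "can_avoid G \<H>"
    proof (rule can_avoid_if_embeds[OF G(1) _ _ inj _ edge av simple])
      show "finite (edges (labeled_complete_graph L n))"
        using finite_edges[OF simple_graph_complete_graph] by simp
      show "edge_ordering (labeled_complete_graph L n) (eord (labeled_complete_graph L n))"
        by (rule edge_ordering_labeled_complete_graph[OF L])
    qed (use range in \<open>auto simp: n_def\<close>)
    then show False using G(2) by simp
  qed
qed

text \<open>A graph is \<open>k\<close>-colorable exactly when it is a subgraph of a complete
  \<open>k\<close>-partite graph with large enough classes, so these graphs play the role that
  complete graphs play in the infinite case.\<close>

lemma order_chromatic_number_greater_iff: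
  assumes simple: "\<forall>H\<in>\<H>. simple_graph H"
  shows "order_chromatic_number \<H> > enat k \<longleftrightarrow>
    (\<forall>n\<ge>1. \<exists>R. canonical_edge_ordering k n R \<and>
       avoids (with_order (complete_multipartite k n) R) \<H>)"
proof
  assume gt: "order_chromatic_number \<H> > enat k"
  show "\<forall>n\<ge>1. \<exists>R. canonical_edge_ordering k n R \<and>
       avoids (with_order (complete_multipartite k n) R) \<H>"
  proof (intro allI impI, rule ccontr)
    fix n :: nat
    assume no: "\<not> (\<exists>R. canonical_edge_ordering k n R \<and>
       avoids (with_order (complete_multipartite k n) R) \<H>)"
    obtain N where N: "\<And>R. edge_ordering (complete_multipartite k N) R \<Longrightarrow>
      \<exists>R' f. canonical_edge_ordering k n R' \<and>
        embeds f (with_order (complete_multipartite k n) R') (with_order (complete_multipartite k N) R)"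
      using ramsey_complete_multipartite by blast
    let ?K = "complete_multipartite k N"
    have not_avoid: "\<not> can_avoid ?K \<H>"
      unfolding can_avoid_def using N avoids_embeds[OF _ _ simple] no by blast
    \<comment> \<open>Hosts in \<open>order_chromatic_number\<close> have natural numbers as
      vertices, so the multipartite graph is transported along the pairing function.\<close>
    define G :: "nat sgraph" where
      "G = \<lparr>verts = prod_encode ` verts ?K, edges = (`) prod_encode ` edges ?K\<rparr>"
    have G: "simple_graph G"
    proof -
      have "prod_encode ` e \<in> [prod_encode ` verts ?K]\<^bsup>2\<^esup>" if "e \<in> edges ?K" for e
      proof -
        from simple_graph_complete_multipartite that
        obtain u v where "e = {u, v}" "u \<in> verts ?K" "v \<in> verts ?K" "u \<noteq> v"
          by (rule simple_graph_edgeE)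
        then show ?thesis by (auto simp: prod_encode_eq)
      qed
      then show ?thesis
        using simple_graph_complete_multipartite[of k N] by (auto simp: G_def simple_graph_def)
    qed
    have "\<not> can_avoid G \<H>"
    proof
      assume "can_avoid G \<H>"
      then obtain R where R: "edge_ordering G R" "avoids (with_order G R) \<H>"
        unfolding can_avoid_def by blast
      have "can_avoid ?K \<H>"
      proof (rule can_avoid_if_embeds[OF simple_graph_complete_multipartite _ _ _ _ _ R(2) simple])
        show "finite (edges (with_order G R))" using finite_edges[OF G] by (simp add: with_order_def)
        show "edge_ordering (with_order G R) (eord (with_order G R))"
          using R(1) by (simp add: with_order_def edge_ordering_def)
        show "inj_on prod_encode (verts ?K)" by (rule inj_prod_encode)
      qed (auto simp: with_order_def G_def)
      then show False using not_avoid by simp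
    qed
    moreover have "chromatic_number G \<le> k"
    proof (rule chromatic_number_le)
      show "colorable G k"
        unfolding colorable_def
      \<comment> \<open>The class is the colour; classes count from 1 and colours from 0.\<close>
      proof (intro exI[of _ "\<lambda>v. fst (prod_decode v) - 1"] conjI ballI impI)
        show "(\<lambda>v. fst (prod_decode v) - 1) ` verts G \<subseteq> {..<k}"
          by (auto simp: G_def complete_multipartite_def)
        fix u v assume uv: "u \<in> verts G" "v \<in> verts G" "{u, v} \<in> edges G"
        then obtain i a j b where e: "u = prod_encode (i, a)" "v = prod_encode (j, b)"
          "i \<in> {1..k}" "j \<in> {1..k}" by (auto simp: G_def complete_multipartite_def)
        have "prod_encode ` {(i, a), (j, b)} \<in> (`) prod_encode ` edges ?K"
          using uv(3) e by (simp add: G_def)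
        then have "{(i, a), (j, b)} \<in> edges ?K"
          by (auto simp only: inj_image_eq_iff[OF inj_prod_encode] elim!: imageE)
        then show "fst (prod_decode u) - 1 \<noteq> fst (prod_decode v) - 1"
          using e by (auto simp: multipartite_edge_iff)
      qed
    qed
    ultimately have "order_chromatic_number \<H> \<le> enat k"
      using order_chromatic_number_le[OF G] by (meson enat_ord_simps(1) order_trans)
    then show False using gt by simp
  qed
next
  assume av: "\<forall>n\<ge>1. \<exists>R. canonical_edge_ordering k n R \<and>
       avoids (with_order (complete_multipartite k n) R) \<H>"
  show "order_chromatic_number \<H> > enat k"
  proof (rule ccontr)
    assume "\<not> order_chromatic_number \<H> > enat k"
    then have le: "order_chromatic_number \<H> \<le> enat k" by simp
    have "order_chromatic_number \<H> \<noteq> \<infinity>"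
    proof
      assume "order_chromatic_number \<H> = \<infinity>"
      with le show False by simp
    qed
    then obtain G :: "nat sgraph" where G: "simple_graph G" "\<not> can_avoid G \<H>"
      "order_chromatic_number \<H> = enat (chromatic_number G)"
      by (rule order_chromatic_number_attained)
    have "colorable G k"
      by (rule colorable_mono[OF colorable_chromatic_number[OF G(1)]]) (use le G(3) in simp)
    then obtain p :: "nat \<Rightarrow> nat" where p: "p ` verts G \<subseteq> {..<k}"
      "\<And>u v. u \<in> verts G \<Longrightarrow> v \<in> verts G \<Longrightarrow> {u, v} \<in> edges G \<Longrightarrow> p u \<noteq> p v"
      unfolding colorable_def by blast
    define n where "n = Suc (card (verts G))"
    obtain R where R: "canonical_edge_ordering k n R"
      "avoids (with_order (complete_multipartite k n) R) \<H>"
      using av[rule_format, of n] by (auto simp: n_def)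
    obtain c :: "nat \<Rightarrow> nat" where c: "bij_betw c (verts G) {0..<card (verts G)}"
      using ex_bij_betw_finite_nat G(1) unfolding simple_graph_def by blast
    have range: "Suc (p v) \<in> {1..k} \<and> Suc (c v) \<in> {1..n}" if "v \<in> verts G" for v
      using bij_betwE[OF c] p(1) that by (auto simp: n_def Suc_le_eq)
    have "can_avoid G \<H>"
    proof (rule can_avoid_if_embeds[OF G(1) _ _ _ _ _ R(2) simple])
      show "finite (edges (with_order (complete_multipartite k n) R))"
        using finite_edges[OF simple_graph_complete_multipartite] by (simp add: with_order_def)
      show "edge_ordering (with_order (complete_multipartite k n) R)
          (eord (with_order (complete_multipartite k n) R))"
        using R(1) by (simp add: with_order_def edge_ordering_def canonical_edge_ordering_def)
      \<comment> \<open>The first coordinate is the colour, which sends edges between different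
        classes. The second numbers all vertices of \<open>G\<close>, so it alone ensures
        injectivity, and each class has room for every vertex.\<close>
      show "inj_on (\<lambda>v. (Suc (p v), Suc (c v))) (verts G)"
        using c by (auto simp: bij_betw_def inj_on_def)
      show "(\<lambda>v. (Suc (p v), Suc (c v))) ` verts G \<subseteq>
          verts (with_order (complete_multipartite k n) R)"
        using range by (auto simp: with_order_def complete_multipartite_def)
      show "(\<lambda>v. (Suc (p v), Suc (c v))) ` e \<in> edges (with_order (complete_multipartite k n) R)"
        if "e \<in> edges G" for e
      proof -
        from G(1) that obtain u v where e: "e = {u, v}" "u \<in> verts G" "v \<in> verts G" "u \<noteq> v"
          by (rule simple_graph_edgeE)
        then have "p u \<noteq> p v" using p(2) that by blast
        then show ?thesis
          using e range[of u] range[of v] by (simp add: with_order_def multipartite_edge_iff)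
      qed
    qed
    then show False using G(2) by simp
  qed
qed

theorem theorem2p5:
  fixes \<H> :: "'a eograph set"
  assumes "\<forall>H\<in>\<H>. edge_ordered_graph H"
    and "\<forall>H\<in>\<H>. edges H \<noteq> {}"
  shows "(order_chromatic_number \<H> = \<infinity> \<longleftrightarrow>
            (\<exists>L\<in>canonical_labelings. \<forall>n\<ge>1. avoids (labeled_complete_graph L n) \<H>)) \<and>
         (\<forall>k\<ge>2. order_chromatic_number \<H> > enat k \<longleftrightarrow>
            (\<forall>n\<ge>1. \<exists>R. canonical_edge_ordering k n R \<and>
               avoids (with_order (complete_multipartite k n) R) \<H>))"
proof -
  have "\<forall>H\<in>\<H>. simple_graph H" using assms(1) by (simp add: edge_ordered_graph_def)
  then show ?thesis
    using infinite_order_chromatic_number_iff order_chromatic_number_greater_iff by blast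
qed

end
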